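(* Let $v$ be a complex-valued potential on $\mathbb R^3$ with $v(x)=\widetilde v(|x|)$, $\widetilde v\in L^\infty(\mathbb R_+)$, $\widetilde v(r)=\alpha/r$ for $r\ge R_a$, for some constants $\alpha\in\mathbb R$, $R_a>0$, and let $k\in\mathbb R_+\setminus\Sigma^P_v$ be fixed. Let $\ell\ge0$ and $|m|\le\ell$ be integers. Assume that the random function $f^m_\ell$ on $\mathbb R_+$ satisfies $$\mathbb E\bigl(\overline{f^m_\ell(r)}\,f^m_\ell(r+\xi)\bigr)=\Pi\,\delta_0(\xi)\bigl(-\operatorname{Im}\widetilde v(r)+k\,\delta_R(r)\bigr)$$ for some $\Pi>0$ and $R\ge R_a$, and let $\varphi^m_{v,\ell}$ be the corresponding radial radiation solution $$\varphi^m_{v,\ell}(r)=\int_0^\infty G_{v,\ell}(r,r')f^m_\ell(r')\,dr'.$$ Then at fixed $r_1,r_2>0$ (and fixed $\Pi$) $$\Pi\,\operatorname{Im}G_{v,\ell}(r_1,r_2)=\mathbb E\bigl(\overline{\varphi^m_{v,\ell}(r_1)}\,\varphi^m_{v,\ell}(r_2)\bigr)+O(\tfrac1R),\qquad R\to+\infty.$$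
   Context: $\mathbb R_+=(0,\infty)$; $\delta_a$ is the Dirac delta centred at $a$. The covariance condition is understood in the sense of distributions: for test functions $g_1,g_2$ (in particular $g_i=G_{v,\ell}(r_i,\cdot)$), $\mathbb E\bigl(\overline{\int f^m_\ell g_1\,dr}\int f^m_\ell g_2\,dr\bigr)=\Pi\bigl(-\int_0^\infty\operatorname{Im}\widetilde v(r)\,\overline{g_1(r)}g_2(r)\,dr+k\,\overline{g_1(R)}g_2(R)\bigr)$. The source $f^m_\ell$ depends on $R$ through this condition; note $\operatorname{Im}\widetilde v(r)=0$ for $r\ge R_a$. $\Sigma^P_v$: Put $L_v=-\Delta+v$ on $L^2(\mathbb R^3)$. The resolvent $(L_v-k^2)^{-1}$ is meromorphic in $k$ in $\{\operatorname{Im}k>0\}$; its distributional kernel $G_v(x,x';k)$ admits a unique meromorphic continuation across the positive real axis. For $k\in\mathbb R_+$ this kernel is the radiation Green's function. $\Sigma^P_v\subset\mathbb R_+$ is the union of the sets of positive poles $k$ of $G_v(x,x';k)$ and of $G_{\overline v}(x,x';k)$. Radial Green's function: $G_{v,\ell}(r,r')$ is the coefficient in the expansion $G_v(r\vartheta,r'\vartheta')=\frac1{rr'}\sum_{\ell\ge0}\sum_{|m|\le\ell}G_{v,\ell}(r,r')Y^m_\ell(\vartheta)\overline{Y^m_\ell(\vartheta')}$, $\vartheta,\vartheta'\in S^2$, with $Y^m_\ell$ the orthonormal spherical harmonics. Equivalently it is the outgoing Green's function of the radial operator $L_{v,\ell}=-\frac{d^2}{dr^2}+\frac{\ell(\ell+1)}{r^2}+\widetilde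 v$: for each $r'>0$, $(L_{v,\ell}-k^2)G_{v,\ell}(\cdot,r')=\delta_{r'}$ on $\mathbb R_+$, $G_{v,\ell}(r,r')=O(r^{\ell+1})$ as $r\to+0$, and $G_{v,\ell}(r,r')$ is, for all large $r$, a constant multiple of the Coulomb function $H^+_\ell(\eta,kr)$, $\eta=\alpha/(2k)$. Here $H^+_\ell(\eta,kr)$ is the unique solution on $r>0$ of $-\varphi''+\frac{\ell(\ell+1)}{r^2}\varphi+\frac\alpha r\varphi-k^2\varphi=0$ with $H^+_\ell(\eta,kr)=\exp(i\theta_\ell(\eta,kr))+O(1/r)$ as $r\to+\infty$, $\theta_\ell(\eta,kr)=kr-\eta\ln(2kr)-\frac12\ell\pi+\arg\Gamma(\ell+1+i\eta)$. The functions $f^m_\ell$ and $\varphi^m_{v,\ell}$ arise as coefficients in $f(r\vartheta)=\frac1r\sum f^m_\ell(r)Y^m_\ell(\vartheta)$, $\psi_v(r\vartheta)=\frac1r\sum\varphi^m_{v,\ell}(r)Y^m_\ell(\vartheta)$ for the radiation solution $\psi_v$ of $(L_v-k^2)\psi_v=f$. *)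

theory Defs
  imports "HOL-Complex_Analysis.Complex_Analysis" "HOL-Probability.Probability"
    "HOL-Library.Landau_Symbols"
begin

definition pdiff :: "'a \<Rightarrow> ('a::euclidean_space \<Rightarrow> complex) \<Rightarrow> 'a \<Rightarrow> complex" where
  "pdiff b g = (\<lambda>x. frechet_derivative g (at x) b)"

definition laplacian :: "('a::euclidean_space \<Rightarrow> complex) \<Rightarrow> 'a \<Rightarrow> complex" where
  "laplacian g x = (\<Sum>b\<in>Basis. pdiff b (pdiff b g) x)"

text \<open>Smoothness: all iterated partial derivatives exist and are (Frechet) differentiable.\<close>

definition smooth_fun :: "('a::euclidean_space \<Rightarrow> complex) \<Rightarrow> bool" where
  "smooth_fun g \<longleftrightarrow> (\<forall>bs. set bs \<subseteq> Basis \<longrightarrow> (\<forall>x. foldr pdiff bs g differentiable (at x)))"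

definition test_functions :: "'a::euclidean_space set \<Rightarrow> ('a \<Rightarrow> complex) set" where
  "test_functions U =
     {g. smooth_fun g \<and> (\<exists>K. compact K \<and> K \<subseteq> U \<and> (\<forall>x. x \<notin> K \<longrightarrow> g x = 0))}"

definition square_integrable :: "('a::euclidean_space \<Rightarrow> complex) set" where
  "square_integrable =
     {u. u \<in> borel_measurable lebesgue \<and> integrable lebesgue (\<lambda>x. (norm (u x))\<^sup>2)}"

text \<open>
  The graph of \<open>L\<^sub>v = - \<Delta> + v\<close> on \<open>L\<^sup>2(\<real>\<^sup>3)\<close>, acting in the sense of distributions on its maximal
  domain (which is the Sobolev space \<open>H\<^sup>2\<close> when \<open>v\<close> is bounded). Elements of \<open>L\<^sup>2\<close> are represented
  by functions, so the relation is functional and injective only up to null sets.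
\<close>

definition schroedinger_graph ::
    "(real^3 \<Rightarrow> complex) \<Rightarrow> ((real^3 \<Rightarrow> complex) \<times> (real^3 \<Rightarrow> complex)) set" where
  "schroedinger_graph v =
     {(u, f). u \<in> square_integrable \<and> f \<in> square_integrable \<and>
        (\<forall>\<phi> \<in> test_functions UNIV.
           (LINT x|lebesgue. u x * (- laplacian \<phi> x + v x * \<phi> x)) = (LINT x|lebesgue. f x * \<phi> x))}"

definition is_resolvent_value ::
    "(real^3 \<Rightarrow> complex) \<Rightarrow> complex \<Rightarrow> (real^3 \<Rightarrow> complex) \<Rightarrow> (real^3 \<Rightarrow> complex) \<Rightarrow> bool" where
  "is_resolvent_value v z f u \<longleftrightarrow> (u, \<lambda>x. f x + z * u x) \<in> schroedinger_graph v"

text \<open>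
  The norm bound is required of every solution; with \<open>f = 0\<close> it gives uniqueness up to null sets.
\<close>

definition resolvent_set :: "(real^3 \<Rightarrow> complex) \<Rightarrow> complex set" where
  "resolvent_set v =
     {z. \<exists>C. \<forall>f \<in> square_integrable.
        (\<exists>u. is_resolvent_value v z f u) \<and>
        (\<forall>u. is_resolvent_value v z f u \<longrightarrow>
           (LINT x|lebesgue. (norm (u x))\<^sup>2) \<le> C * (LINT x|lebesgue. (norm (f x))\<^sup>2))}"

text \<open>
  The distributional kernel \<open>G\<^sub>v(x, x'; \<kappa>)\<close> of \<open>(L\<^sub>v - \<kappa>\<^sup>2)\<^sup>-\<^sup>1\<close> evaluated on the product test function
  \<open>h(x) g(x')\<close>; such products determine a distribution on \<open>\<real>\<^sup>3 \<times> \<real>\<^sup>3\<close>.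
\<close>

definition green_kernel ::
    "(real^3 \<Rightarrow> complex) \<Rightarrow> complex \<Rightarrow> (real^3 \<Rightarrow> complex) \<Rightarrow> (real^3 \<Rightarrow> complex) \<Rightarrow> complex" where
  "green_kernel v \<kappa> h g =
     (LINT x|lebesgue. h x * (SOME u. is_resolvent_value v (\<kappa>\<^sup>2) g u) x)"

text \<open>
  A point \<open>k\<close> of the positive half axis is a pole of the kernel if, for some test functions, the
  meromorphic continuation from the upper half plane to a neighbourhood of \<open>k\<close> has a pole at \<open>k\<close>.
  The continuation is unique because the upper half of a disc is a uniqueness set.
\<close>

definition green_kernel_pole :: "(real^3 \<Rightarrow> complex) \<Rightarrow> real \<Rightarrow> bool" where
  "green_kernel_pole v k \<longleftrightarrow>
     (\<exists>h \<in> test_functions UNIV. \<exists>g \<in> test_functions UNIV. \<exists>F \<epsilon>. \<epsilon> > 0 \<and>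
        F meromorphic_on ball (complex_of_real k) \<epsilon> \<and>
        (\<forall>\<kappa> \<in> ball (complex_of_real k) \<epsilon>. Im \<kappa> > 0 \<and> \<kappa>\<^sup>2 \<in> resolvent_set v \<longrightarrow>
           F \<kappa> = green_kernel v \<kappa> h g) \<and>
        is_pole F (complex_of_real k))"

definition Sigma_P :: "(real^3 \<Rightarrow> complex) \<Rightarrow> real set" where
  "Sigma_P v = {k. k > 0 \<and> (green_kernel_pole v k \<or> green_kernel_pole (\<lambda>x. cnj (v x)) k)}"

definition coulomb_phase :: "nat \<Rightarrow> real \<Rightarrow> real \<Rightarrow> real" where
  "coulomb_phase l \<eta> \<rho> =
     \<rho> - \<eta> * ln (2 * \<rho>) - real l * pi / 2 + Arg (Gamma (Complex (real l + 1) \<eta>))"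

text \<open>
  \<open>h\<close> is \<open>r \<mapsto> H\<^sup>+\<^sub>l(\<eta>, k r)\<close> on \<open>r > 0\<close>, with \<open>\<eta> = \<alpha> / (2 k)\<close>; these properties determine \<open>h\<close> there.
\<close>

definition is_coulomb_Hplus :: "real \<Rightarrow> real \<Rightarrow> nat \<Rightarrow> (real \<Rightarrow> complex) \<Rightarrow> bool" where
  "is_coulomb_Hplus \<alpha> k l h \<longleftrightarrow>
     (\<exists>h' h''. \<forall>r>0.
        (h has_vector_derivative h' r) (at r) \<and> (h' has_vector_derivative h'' r) (at r) \<and>
        - h'' r + of_real (real (l * (l + 1)) / r\<^sup>2) * h r + of_real (\<alpha> / r) * h r
          - of_real (k\<^sup>2) * h r = 0) \<and>
     (\<lambda>r. h r - exp (\<i> * of_real (coulomb_phase l (\<alpha> / (2 * k)) (k * r))))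
       \<in> O[at_top](\<lambda>r. complex_of_real (1 / r))"

text \<open>
  \<open>G\<close> is the outgoing Green's function of \<open>- d\<^sup>2/dr\<^sup>2 + l(l+1)/r\<^sup>2 + vt - k\<^sup>2\<close> on \<open>{0<..}\<close>. The equation with
  the delta source is meant in the sense of distributions in \<open>r\<close>; continuity selects the
  representative for which the point values \<open>G r r'\<close> make sense.
\<close>

definition is_radial_green ::
    "(real \<Rightarrow> complex) \<Rightarrow> real \<Rightarrow> real \<Rightarrow> nat \<Rightarrow> (real \<Rightarrow> real \<Rightarrow> complex) \<Rightarrow> bool" where
  "is_radial_green vt \<alpha> k l G \<longleftrightarrow>
     (\<forall>r'>0.
        continuous_on {0<..} (\<lambda>r. G r r') \<and>
        (\<forall>\<phi> \<in> test_functions {0<..}.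
           (LINT r|lebesgue_on {0<..}.
              G r r' * (- laplacian \<phi> r
                        + (of_real (real (l * (l + 1)) / r\<^sup>2) + vt r - of_real (k\<^sup>2)) * \<phi> r)) = \<phi> r') \<and>
        (\<lambda>r. G r r') \<in> O[at_right 0](\<lambda>r. complex_of_real (r ^ (l + 1))) \<and>
        (\<exists>h c. is_coulomb_Hplus \<alpha> k l h \<and> (\<forall>\<^sub>F r in at_top. G r r' = c * h r)))"

text \<open>
  A random source on \<open>{0<..}\<close> is a generalized random function: \<open>F g\<close> is the random variable written
  \<open>\<integral> f(r) g(r) dr\<close>. The functions \<open>g\<close> it is tested against are the continuous functions on \<open>{0<..}\<close>
  that are bounded near the origin; there is no condition at infinity, since the covariances below
  are supported in a bounded interval. This class contains the smooth compactly supported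
  functions and the radial Green's functions \<open>G r\<close>, as required in the definition of the
  radiation solution.
\<close>

definition source_test_functions :: "(real \<Rightarrow> complex) set" where
  "source_test_functions = {g. continuous_on {0<..} g \<and> bounded (g ` {0<..1})}"

definition random_source :: "'w measure \<Rightarrow> ((real \<Rightarrow> complex) \<Rightarrow> 'w \<Rightarrow> complex) \<Rightarrow> bool" where
  "random_source M F \<longleftrightarrow> prob_space M \<and>
     (\<forall>g \<in> source_test_functions.
        F g \<in> borel_measurable M \<and> integrable M (\<lambda>\<omega>. (norm (F g \<omega>))\<^sup>2)) \<and>
     (\<forall>g \<in> source_test_functions. \<forall>h \<in> source_test_functions. \<forall>a b.
        AE \<omega> in M. F (\<lambda>r. a * g r + b * h r) \<omega> = a * F g \<omega> + b * F h \<omega>)"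

text \<open>
  The condition \<open>E(cnj (f r) * f (r + \<xi>)) = P \<delta>\<^sub>0(\<xi>) (- Im (vt r) + k \<delta>\<^sub>R(r))\<close> in the sense of
  distributions.
\<close>

definition source_covariance ::
    "(real \<Rightarrow> complex) \<Rightarrow> real \<Rightarrow> real \<Rightarrow> real \<Rightarrow> 'w measure \<Rightarrow>
      ((real \<Rightarrow> complex) \<Rightarrow> 'w \<Rightarrow> complex) \<Rightarrow> bool" where
  "source_covariance vt k P R M F \<longleftrightarrow>
     (\<forall>g1 \<in> source_test_functions. \<forall>g2 \<in> source_test_functions.
        (LINT \<omega>|M. cnj (F g1 \<omega>) * F g2 \<omega>) =
          of_real P * (- (LINT r|lebesgue_on {0<..}. of_real (Im (vt r)) * cnj (g1 r) * g2 r)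
                       + of_real k * cnj (g1 R) * g2 R))"

text \<open>The radiation solution \<open>\<integral> G r r' f(r') dr'\<close>.\<close>

definition radiation_solution ::
    "(real \<Rightarrow> real \<Rightarrow> complex) \<Rightarrow> ((real \<Rightarrow> complex) \<Rightarrow> 'w \<Rightarrow> complex) \<Rightarrow> real \<Rightarrow> 'w \<Rightarrow> complex" where
  "radiation_solution G F r \<omega> = F (\<lambda>r'. G r r') \<omega>"

end

theory Submission
  imports Defs
begin

text \<open>
  Write \<open>u\<^sub>s = G(\<cdot>, s)\<close> and apply Green's identity to \<open>cnj u\<^sub>s\<close> and \<open>u\<^sub>t\<close> on \<open>(0, R)\<close>. The boundary term at
  \<open>0\<close> vanishes, the delta sources contribute \<open>G(s, t) - cnj (G(t, s))\<close>, and the potential contributes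
  \<open>2 i\<close> times the integral of \<open>Im v cnj u\<^sub>s u\<^sub>t\<close>. Since both functions are multiples of the outgoing
  Coulomb wave near \<open>R\<close>, the Wronskian at \<open>R\<close> is \<open>2 i k cnj (u\<^sub>s(R)) u\<^sub>t(R) + O(1/R)\<close>. The same identity
  without conjugation gives \<open>G(s, t) = G(t, s)\<close>, so the left-hand side becomes \<open>2 i Im G(s, t)\<close>, and
  the remaining terms are exactly the covariance of the source tested against \<open>G(s, \<cdot>)\<close>, \<open>G(t, \<cdot>)\<close>.
  Green's identity is available because a distributional solution of the equation with delta source
  is, up to a ramp, a twice iterated integral of a bounded measurable function.
\<close>

section \<open>Smooth functions on the line\<close>

text \<open>Once R exceeds Ra, s and t, the integrated identity is exact and its volume term no
  longer depends on R, because Im v vanishes beyond Ra; the error comes only from replacing the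
  derivative at R by i k times the function, and its rate is that of the Coulomb asymptotics. Three
  obstacles shape the proof. The equation is given weakly and in the first argument of G, whereas
  the source is tested against the second; symmetry is therefore needed already to see that
  \<open>G r\<close> is an admissible test function. The coefficient is merely measurable, so a
  solution has no classical second derivative, and integration by parts is done for primitives of
  bounded measurable functions. Finally, the hypotheses at 0 and at infinity bound values, while
  Wronskians contain derivatives; both gaps are closed by one interpolation inequality, which bounds
  a derivative by the values of the function and the oscillation of the derivative, on [y, 2y] near
  0 and on [r, r + 1] near infinity.\<close>

primrec k_times_diff :: "nat \<Rightarrow> (real \<Rightarrow> complex) \<Rightarrow> bool" where
  "k_times_diff 0 f = True"
| "k_times_diff (Suc n) f =
     (\<exists>f'. (\<forall>x. (f has_vector_derivative f' x) (at x)) \<and> k_times_diff n f')"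

lemma k_times_diff_SucD: "k_times_diff (Suc n) f \<Longrightarrow> k_times_diff n f"
proof (induction n arbitrary: f)
  case (Suc n)
  obtain f' where f': "\<forall>x. (f has_vector_derivative f' x) (at x)" "k_times_diff (Suc n) f'"
    using Suc.prems unfolding k_times_diff.simps(2)[of "Suc n"] by blast
  then have "k_times_diff n f'" using Suc.IH by blast
  with f' show ?case unfolding k_times_diff.simps(2)[of n] by blast
qed simp

lemma k_times_diff_add:
  "k_times_diff n f \<Longrightarrow> k_times_diff n g \<Longrightarrow> k_times_diff n (\<lambda>x. f x + g x)"
proof (induction n arbitrary: f g)
  case (Suc n)
  obtain f' where f': "\<forall>x. (f has_vector_derivative f' x) (at x)" "k_times_diff n f'"
    using Suc.prems(1) by auto
  obtain g' where g': "\<forall>x. (g has_vector_derivative g' x) (at x)" "k_times_diff n g'"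
    using Suc.prems(2) by auto
  then show ?case
    using Suc.IH[of f' g'] f' g'
    by (auto intro!: exI[of _ "\<lambda>x. f' x + g' x"] derivative_intros)
qed simp

lemma k_times_diff_mult:
  "k_times_diff n f \<Longrightarrow> k_times_diff n g \<Longrightarrow> k_times_diff n (\<lambda>x. f x * g x)"
proof (induction n arbitrary: f g)
  case (Suc n)
  obtain f' where f': "\<forall>x. (f has_vector_derivative f' x) (at x)" "k_times_diff n f'"
    using Suc.prems(1) by auto
  obtain g' where g': "\<forall>x. (g has_vector_derivative g' x) (at x)" "k_times_diff n g'"
    using Suc.prems(2) by auto
  have "k_times_diff n (\<lambda>x. f x * g' x + f' x * g x)"
    using Suc.IH[OF k_times_diff_SucD[OF Suc.prems(1)] g'(2)]
      Suc.IH[OF f'(2) k_times_diff_SucD[OF Suc.prems(2)]]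
    by (rule k_times_diff_add)
  then show ?case
    using f' g' by (auto intro!: exI[of _ "\<lambda>x. f x * g' x + f' x * g x"] has_vector_derivative_mult)
qed simp

lemma k_times_diff_const: "k_times_diff n (\<lambda>x. c)"
  by (induction n arbitrary: c) (auto intro!: exI[of _ "\<lambda>x. 0"])

lemma has_vector_derivative_affine_comp:
  fixes f :: "real \<Rightarrow> complex"
  assumes "(f has_vector_derivative d) (at (a * x + b))"
  shows "((\<lambda>x. f (a * x + b)) has_vector_derivative of_real a * d) (at x)"
proof -
  have "((\<lambda>x. a * x + b) has_vector_derivative a) (at x)"
    by (auto intro!: derivative_eq_intros)
  from vector_diff_chain_at[OF this assms] show ?thesis
    by (simp add: o_def scaleR_conv_of_real)
qed

lemma k_times_diff_affine_comp: "k_times_diff n f \<Longrightarrow> k_times_diff n (\<lambda>x. f (a * x + b))"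
proof (induction n arbitrary: f)
  case (Suc n)
  obtain f' where "\<forall>x. (f has_vector_derivative f' x) (at x)" "k_times_diff n f'"
    using Suc.prems by auto
  then show ?case
    using Suc.IH[of f']
    by (auto intro!: exI[of _ "\<lambda>x. of_real a * f' (a * x + b)"] has_vector_derivative_affine_comp
        k_times_diff_mult k_times_diff_const)
qed simp

lemma pdiff_eqI:
  assumes "(g has_vector_derivative d) (at x)"
  shows "pdiff 1 g x = d"
proof -
  have "frechet_derivative g (at x) = (\<lambda>h. h *\<^sub>R d)"
    using assms unfolding has_vector_derivative_def by (rule frechet_derivative_at[symmetric])
  then show ?thesis by (simp add: pdiff_def)
qed

lemma differentiable_has_pdiff:
  fixes g :: "real \<Rightarrow> complex"
  assumes "g differentiable (at x)"
  shows "(g has_vector_derivative pdiff 1 g x) (at x)"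
proof -
  have "(g has_vector_derivative vector_derivative g (at x)) (at x)"
    using assms by (simp add: vector_derivative_works)
  then show ?thesis using pdiff_eqI by metis
qed

lemma k_times_diff_pdiff: "k_times_diff (Suc n) g \<Longrightarrow> k_times_diff n (pdiff 1 g)"
proof -
  assume "k_times_diff (Suc n) g"
  then obtain g' where g': "\<forall>x. (g has_vector_derivative g' x) (at x)" "k_times_diff n g'"
    by auto
  then have "pdiff 1 g = g'" by (auto intro: pdiff_eqI)
  with g' show ?thesis by simp
qed

text \<open>\<open>smooth_fun\<close> speaks of iterated Frechet derivatives, which are awkward for
  composite functions. \<open>k_times_diff\<close> has easy closure properties, and this lemma
  transfers them: in dimension one the only basis vector is 1, so each
  \<open>foldr pdiff bs g\<close> is an iterated derivative.\<close>

lemma smooth_fun_if_k_times_diff: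
  assumes "\<And>n. k_times_diff n g"
  shows "smooth_fun g"
  unfolding smooth_fun_def
proof (intro allI impI)
  fix bs :: "real list" and x :: real assume bs: "set bs \<subseteq> Basis"
  have "k_times_diff n (foldr pdiff bs g)" for n
    using bs by (induction bs arbitrary: n)
      (auto intro: assms k_times_diff_pdiff simp del: k_times_diff.simps)
  from this[of "Suc 0"] show "foldr pdiff bs g differentiable (at x)"
    by (auto intro: differentiableI_vector)
qed

lemma laplacian_real: "laplacian \<phi> (x::real) = pdiff 1 (pdiff 1 \<phi>) x"
  by (simp add: laplacian_def)

lemma smooth_fun_pdiff:
  fixes \<phi> :: "real \<Rightarrow> complex"
  assumes "smooth_fun \<phi>"
  shows "smooth_fun (pdiff 1 \<phi>)"
  unfolding smooth_fun_def
proof (intro allI impI)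
  fix bs :: "real list" and x :: real assume "set bs \<subseteq> Basis"
  then have "set (bs @ [1]) \<subseteq> Basis" by auto
  then have "foldr pdiff (bs @ [1]) \<phi> differentiable (at x)"
    using assms unfolding smooth_fun_def by blast
  then show "foldr pdiff bs (pdiff 1 \<phi>) differentiable (at x)" by simp
qed

lemma smooth_fun_has_vector_derivative:
  fixes \<phi> :: "real \<Rightarrow> complex"
  assumes "smooth_fun \<phi>"
  shows "(\<phi> has_vector_derivative pdiff 1 \<phi> x) (at x)"
  using assms[unfolded smooth_fun_def, rule_format, of "[]"]
  by (intro differentiable_has_pdiff) simp

lemma smooth_fun_continuous_on:
  fixes g :: "real \<Rightarrow> complex"
  assumes "smooth_fun g"
  shows "continuous_on T g"
  using smooth_fun_has_vector_derivative[OF assms]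
  by (meson continuous_at_imp_continuous_on has_vector_derivative_continuous)

section \<open>A smooth bump and weakly affine functions\<close>

text \<open>Under t = 1/x this is the decay of a polynomial times exp (-t) at infinity.\<close>

lemma exp_inverse_flat:
  "((\<lambda>x. poly P (inverse x) * exp (- inverse x) :: real) \<longlongrightarrow> 0) (at_right 0)"
proof -
  have "((\<lambda>t. poly P t * exp (- t) :: real) \<longlongrightarrow> 0) at_top"
  proof -
    have "((\<lambda>t. \<Sum>i\<le>degree P. coeff P i * (t ^ i / exp t)) \<longlongrightarrow> (\<Sum>i\<le>degree P. coeff P i * (0::real))) at_top"
      by (intro tendsto_intros tendsto_power_div_exp_0)
    then show ?thesis
      by (simp add: poly_altdef exp_minus divide_inverse sum_distrib_right mult.assoc)
  qed
  then show ?thesis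
    using filterlim_compose filterlim_inverse_at_top_right by blast
qed

definition flat_exp :: "real poly \<Rightarrow> real \<Rightarrow> complex" where
  "flat_exp P x = (if x > 0 then of_real (poly P (inverse x) * exp (- inverse x)) else 0)"

text \<open>With t = 1/x, differentiation in x turns P(t) exp (-t) into t^2 (P - P')(t) exp (-t);
  the two \<open>pCons 0\<close> are the factor t^2.\<close>

lemma flat_exp_has_vector_derivative:
  "(flat_exp P has_vector_derivative flat_exp (pCons 0 (pCons 0 (P - pderiv P))) x) (at x)"
proof -
  consider "x < 0" | "x > 0" | "x = 0" by linarith
  then show ?thesis
  proof cases
    case 1
    have "((\<lambda>x. 0::complex) has_vector_derivative 0) (at x)" by simp
    then have "(flat_exp P has_vector_derivative 0) (at x)"
      by (rule has_vector_derivative_transform_within_open[where S="{..<0}"])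
        (use 1 in \<open>auto simp: flat_exp_def\<close>)
    with 1 show ?thesis by (simp add: flat_exp_def)
  next
    case 2
    define d where "d = poly (pCons 0 (pCons 0 (P - pderiv P))) (inverse x) * exp (- inverse x)"
    have "((\<lambda>x. poly P (inverse x) * exp (- inverse x)) has_real_derivative d) (at x)"
      unfolding d_def using 2
      by (auto intro!: derivative_eq_intros DERIV_chain2[OF poly_DERIV] simp: algebra_simps power2_eq_square)
    then have "((\<lambda>x. complex_of_real (poly P (inverse x) * exp (- inverse x))) has_vector_derivative of_real d) (at x)"
      by (rule has_vector_derivative_of_real[unfolded o_def])
    then have "(flat_exp P has_vector_derivative of_real d) (at x)"
      by (rule has_vector_derivative_transform_within_open[where S="{0<..}"])
        (use 2 in \<open>auto simp: flat_exp_def\<close>)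
    with 2 show ?thesis by (simp add: flat_exp_def d_def)
  next
    case 3
    have "((\<lambda>y. (flat_exp P y - flat_exp P 0) /\<^sub>R (y - 0)) \<longlongrightarrow> 0) (at 0)"
    proof (rule filterlim_split_at)
      show "((\<lambda>y. (flat_exp P y - flat_exp P 0) /\<^sub>R (y - 0)) \<longlongrightarrow> 0) (at_left 0)"
        by (rule tendsto_eventually) (auto simp: flat_exp_def eventually_at_filter)
      \<comment> \<open>The difference quotient at 0 divides by y, which is one more factor 1/y and
        hence one \<open>pCons 0\<close>.\<close>
      have "((\<lambda>y. complex_of_real (poly (pCons 0 P) (inverse y) * exp (- inverse y))) \<longlongrightarrow> 0) (at_right 0)"
        using tendsto_of_real[OF exp_inverse_flat] by (metis of_real_0)
      then show "((\<lambda>y. (flat_exp P y - flat_exp P 0) /\<^sub>R (y - 0)) \<longlongrightarrow> 0) (at_right 0)"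
        by (rule Lim_transform_eventually)
          (auto simp: flat_exp_def eventually_at_filter scaleR_conv_of_real)
    qed
    then have "(flat_exp P has_vector_derivative 0) (at 0)"
      unfolding has_vector_derivative_def has_derivative_iff_norm
      by (simp add: tendsto_norm_zero_iff[symmetric, where f="\<lambda>y. _ y /\<^sub>R _ y"] divide_inverse mult.commute)
    with 3 show ?thesis by (simp add: flat_exp_def)
  qed
qed

lemma k_times_diff_flat_exp: "k_times_diff n (flat_exp P)"
  by (induction n arbitrary: P) (auto intro: flat_exp_has_vector_derivative)

text \<open>\<open>\<psi>\<close> is a bump, \<open>A\<close> its primitive, a smoothed step of
  height \<open>m\<close>, and \<open>\<Psi>\<close> the primitive of \<open>A\<close>, a smoothed
  ramp of slope \<open>m\<close>. The mass is left unnormalized: positivity is enough to divide by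
  it at the end.\<close>

lemma smooth_ramp_exists:
  obtains \<Psi> :: "real \<Rightarrow> complex" and A \<psi> :: "real \<Rightarrow> real" and m :: real
  where "\<And>n. k_times_diff n \<Psi>"
    "\<And>x. (\<Psi> has_vector_derivative of_real (A x)) (at x)"
    "\<And>x. (A has_real_derivative \<psi> x) (at x)"
    "continuous_on UNIV \<psi>" "\<And>x. \<psi> x \<ge> 0" "\<And>x. \<bar>x\<bar> \<ge> 1 \<Longrightarrow> \<psi> x = 0"
    "\<And>x. x \<le> -1 \<Longrightarrow> A x = 0" "\<And>x. x \<ge> 1 \<Longrightarrow> A x = m" "m > 0"
    "\<And>x. x \<le> -1 \<Longrightarrow> \<Psi> x = 0" "\<And>x. x \<ge> 1 \<Longrightarrow> \<Psi> x = \<Psi> 1 + of_real (m * (x - 1))"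
proof -
  \<comment> \<open>The factors are flat functions of 1 + x and 1 - x, both positive exactly for |x|
    < 1.\<close>
  define \<beta> where "\<beta> x = flat_exp 1 (1 * x + 1) * flat_exp 1 (-1 * x + 1)" for x
  define \<psi> where "\<psi> x = (if \<bar>x\<bar> < 1 then exp (- inverse (1 + x)) * exp (- inverse (1 - x)) else 0 :: real)" for x
  have \<beta>_eq: "\<beta> = (\<lambda>x. of_real (\<psi> x))"
    by (auto simp: \<beta>_def \<psi>_def flat_exp_def fun_eq_iff add.commute)
  have \<beta>_smooth: "k_times_diff n \<beta>" for n
    unfolding \<beta>_def by (intro k_times_diff_mult k_times_diff_affine_comp k_times_diff_flat_exp)
  have "continuous_on UNIV \<beta>"
  proof -
    obtain \<beta>' where "\<And>x. (\<beta> has_vector_derivative \<beta>' x) (at x)"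
      using \<beta>_smooth[of "Suc 0"] by auto
    then show ?thesis
      by (meson continuous_at_imp_continuous_on has_vector_derivative_continuous)
  qed
  then have "continuous_on UNIV (\<lambda>x. Re (\<beta> x))" by (intro continuous_intros)
  then have \<psi>_cont: "continuous_on UNIV \<psi>" by (simp add: \<beta>_eq)
  then have "isCont \<psi> x" for x by (simp add: continuous_on_eq_continuous_at)
  then obtain A0 where A0: "\<And>x. (A0 has_vector_derivative \<psi> x) (at x)"
    using einterval_antiderivative[of "-\<infinity>" "\<infinity>" \<psi>] by auto
  define A where "A x = A0 x - A0 (-1)" for x
  define m where "m = A 1"
  have dA: "(A has_real_derivative \<psi> x) (at x)" for x
    unfolding A_def has_real_derivative_iff_has_vector_derivative
    by (auto intro!: derivative_eq_intros A0)
  then have dAc: "((\<lambda>x. complex_of_real (A x)) has_vector_derivative \<beta> x) (at x)" for x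
    unfolding \<beta>_eq by (intro has_vector_derivative_of_real[unfolded o_def])
  have A_left: "A x = 0" if "x \<le> -1" for x
  proof -
    have "A x = A (-1)"
    proof (rule has_derivative_zero_unique[where f="A" and s="{..-1}"])
      fix y :: real assume "y \<in> {..-1}"
      then have "\<psi> y = 0" by (simp add: \<psi>_def)
      then show "(A has_derivative (\<lambda>h. 0)) (at y within {..-1})"
        using dA[of y] by (auto simp: has_field_derivative_def lambda_zero intro: has_derivative_at_withinI)
    qed (use that in auto)
    then show ?thesis by (simp add: A_def)
  qed
  have A_right: "A x = m" if "x \<ge> 1" for x
    unfolding m_def
  proof (rule has_derivative_zero_unique[where f="A" and s="{1..}"])
    fix y :: real assume "y \<in> {1..}"
    then have "\<psi> y = 0" by (simp add: \<psi>_def)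
    then show "(A has_derivative (\<lambda>h. 0)) (at y within {1..})"
      using dA[of y] by (auto simp: has_field_derivative_def lambda_zero intro: has_derivative_at_withinI)
  qed (use that in auto)
  have \<psi>_nonneg: "\<psi> x \<ge> 0" for x by (simp add: \<psi>_def)
  have "m > 0"
  proof -
    have "A (-1) \<le> A (-1/2)" "A (1/2) \<le> A 1"
      by (rule DERIV_nonneg_imp_nondecreasing, simp, use dA \<psi>_nonneg in blast)+
    moreover have "A (-1/2) < A (1/2)"
      by (rule DERIV_pos_imp_increasing) (use dA in \<open>auto simp: \<psi>_def intro!: exI\<close>)
    ultimately show ?thesis using A_left[of "-1"] by (simp add: m_def)
  qed
  have "isCont (\<lambda>x. complex_of_real (A x)) x" for x
    using dAc[of x] has_vector_derivative_continuous by blast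
  then obtain \<Psi>0 where \<Psi>0: "\<And>x. (\<Psi>0 has_vector_derivative complex_of_real (A x)) (at x)"
    using einterval_antiderivative[of "-\<infinity>" "\<infinity>" "\<lambda>x. complex_of_real (A x)"] by auto
  define \<Psi> where "\<Psi> x = \<Psi>0 x - \<Psi>0 (-1)" for x
  have d\<Psi>: "(\<Psi> has_vector_derivative of_real (A x)) (at x)" for x
    unfolding \<Psi>_def by (auto intro!: derivative_eq_intros \<Psi>0)
  have \<Psi>_left: "\<Psi> x = 0" if "x \<le> -1" for x
  proof -
    have "\<Psi> x = \<Psi> (-1)"
    proof (rule has_derivative_zero_unique[where f="\<Psi>" and s="{..-1}"])
      fix y :: real assume "y \<in> {..-1}"
      then show "(\<Psi> has_derivative (\<lambda>h. 0)) (at y within {..-1})"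
        using d\<Psi>[of y] A_left[of y]
        by (auto simp: has_vector_derivative_def intro: has_derivative_at_withinI)
    qed (use that in auto)
    then show ?thesis by (simp add: \<Psi>_def)
  qed
  have \<Psi>_right: "\<Psi> x = \<Psi> 1 + of_real (m * (x - 1))" if "x \<ge> 1" for x
  proof -
    have "\<Psi> x - of_real (m * x) = \<Psi> 1 - of_real (m * 1)"
    proof (rule has_derivative_zero_unique[where f="\<lambda>x. \<Psi> x - of_real (m * x)" and s="{1..}"])
      fix y :: real assume "y \<in> {1..}"
      moreover have "((\<lambda>x. \<Psi> x - of_real (m * x)) has_vector_derivative of_real (A y) - of_real m) (at y)"
        by (auto intro!: derivative_eq_intros d\<Psi> has_vector_derivative_of_real[unfolded o_def])
      ultimately show "((\<lambda>x. \<Psi> x - of_real (m * x)) has_derivative (\<lambda>h. 0)) (at y within {1..})"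
        using A_right[of y]
        by (auto simp: has_vector_derivative_def intro: has_derivative_at_withinI)
    qed (use that in auto)
    then show ?thesis by (simp add: algebra_simps)
  qed
  have "k_times_diff (Suc (Suc n)) \<Psi>" for n
    unfolding k_times_diff.simps
    by (rule exI[of _ "\<lambda>x. complex_of_real (A x)"] conjI allI d\<Psi> exI[of _ \<beta>] dAc \<beta>_smooth)+
  then have "k_times_diff n \<Psi>" for n
    using k_times_diff_SucD by blast
  moreover have "\<psi> x = 0" if "\<bar>x\<bar> \<ge> 1" for x
    using that by (simp add: \<psi>_def)
  ultimately show ?thesis
    by (rule that[OF _ d\<Psi> dA \<psi>_cont \<psi>_nonneg _ A_left A_right \<open>m > 0\<close> \<Psi>_left \<Psi>_right])
qed

text \<open>The rescaled bump is non-negative, lives within distance \<open>s\<close> of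
  \<open>a\<close> and has total mass \<open>m\<close> there, so the integral differs from
  \<open>m\<close> times \<open>w a\<close> by at most \<open>m\<close> times the oscillation of
  \<open>w\<close> near \<open>a\<close>.\<close>

lemma approximate_identity:
  fixes w :: "real \<Rightarrow> complex" and \<psi> A :: "real \<Rightarrow> real"
  assumes dA: "\<And>x. (A has_real_derivative \<psi> x) (at x)"
    and \<psi>: "continuous_on UNIV \<psi>" "\<And>x. \<psi> x \<ge> 0" "\<And>x. \<bar>x\<bar> \<ge> 1 \<Longrightarrow> \<psi> x = 0"
    and A: "\<And>x. x \<le> -1 \<Longrightarrow> A x = 0" "\<And>x. x \<ge> 1 \<Longrightarrow> A x = m" and m: "m > 0"
    and w: "continuous_on {lo..hi} w" and a: "lo < a" "a < hi"
  shows "((\<lambda>s. integral {lo..hi} (\<lambda>x. of_real (\<psi> ((x - a) / s) / s) * w x)) \<longlongrightarrow> of_real m * w a)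
           (at_right 0)"
proof (rule tendstoI)
  fix \<epsilon> :: real assume \<epsilon>: "\<epsilon> > 0"
  define \<epsilon>' where "\<epsilon>' = \<epsilon> / (2 * m)"
  have \<epsilon>': "\<epsilon>' > 0" "m * \<epsilon>' < \<epsilon>" using \<epsilon> m by (auto simp: \<epsilon>'_def)
  have a_in: "a \<in> {lo..hi}" using a by auto
  obtain \<delta> where \<delta>: "\<delta> > 0" "\<And>x. x \<in> {lo..hi} \<Longrightarrow> dist x a < \<delta> \<Longrightarrow> dist (w x) (w a) < \<epsilon>'"
    using w a_in \<epsilon>'(1) unfolding continuous_on_iff by metis
  \<comment> \<open>Below \<open>\<delta>\<close> the bump sees only points where \<open>w\<close>
    is close to \<open>w a\<close>; below the other two numbers its support stays inside the
    interval, so that no mass is lost.\<close>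
  define s0 where "s0 = min \<delta> (min (a - lo) (hi - a))"
  have "s0 > 0" using \<delta> a by (auto simp: s0_def)
  have main: "dist (integral {lo..hi} (\<lambda>x. of_real (\<psi> ((x - a) / s) / s) * w x)) (of_real m * w a) < \<epsilon>"
    if s: "0 < s" "s < s0" for s
  proof -
    define K where "K x = \<psi> ((x - a) / s) / s" for x
    have K_cont: "continuous_on T K" for T
      unfolding K_def using s
      by (intro continuous_intros continuous_on_compose2[OF \<psi>(1)]) auto
    have "((\<lambda>x. A ((x - a) / s)) has_real_derivative K x) (at x)" for x
      unfolding K_def by (rule DERIV_cong[OF DERIV_chain2[OF dA]])
        (use s in \<open>auto intro!: derivative_eq_intros\<close>)
    then have "(K has_integral A ((hi - a) / s) - A ((lo - a) / s)) {lo..hi}"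
      using a by (intro fundamental_theorem_of_calculus)
        (auto simp flip: has_real_derivative_iff_has_vector_derivative intro: DERIV_subset)
    moreover have "A ((hi - a) / s) = m" "A ((lo - a) / s) = 0"
      using s by (auto intro!: A simp: field_simps s0_def)
    ultimately have K_int: "(K has_integral m) {lo..hi}" by simp
    have "((\<lambda>x. of_real (K x) * w a) has_integral of_real m * w a) {lo..hi}"
      using has_integral_of_real[OF K_int] by (rule has_integral_mult_left)
    moreover have Kw: "(\<lambda>x. of_real (K x) * w x) integrable_on {lo..hi}"
      by (intro integrable_continuous_interval continuous_intros K_cont w)
    ultimately have diff: "((\<lambda>x. of_real (K x) * w x - of_real (K x) * w a) has_integral
        (integral {lo..hi} (\<lambda>x. of_real (K x) * w x) - of_real m * w a)) {lo..hi}"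
      by (intro has_integral_diff) auto
    have "norm (integral {lo..hi} (\<lambda>x. of_real (K x) * w x - of_real (K x) * w a))
        \<le> integral {lo..hi} (\<lambda>x. K x * \<epsilon>')"
    proof (rule integral_norm_bound_integral)
      show "(\<lambda>x. K x * \<epsilon>') integrable_on {lo..hi}"
        by (intro integrable_continuous_interval continuous_intros K_cont)
      show "norm (of_real (K x) * w x - of_real (K x) * w a) \<le> K x * \<epsilon>'" if x: "x \<in> {lo..hi}" for x
      proof (cases "\<bar>x - a\<bar> < s")
        case True
        then have "norm (w x - w a) \<le> \<epsilon>'"
          using \<delta>(2)[OF x] s by (auto simp: dist_norm s0_def)
        moreover have "K x \<ge> 0" using \<psi>(2) s by (simp add: K_def)
        ultimately show ?thesis
          by (simp add: right_diff_distrib[symmetric] norm_mult mult_left_mono del: right_diff_distrib)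
      next
        case False
        then have "K x = 0" using s by (auto simp: K_def intro!: \<psi>(3))
        then show ?thesis by simp
      qed
    qed (use diff in blast)
    also have "integral {lo..hi} (\<lambda>x. K x * \<epsilon>') = m * \<epsilon>'"
      using has_integral_mult_left[OF K_int] by blast
    finally show ?thesis
      using diff \<epsilon>'(2) by (simp add: integral_unique dist_norm K_def)
  qed
  show "\<forall>\<^sub>F s in at_right 0. dist (integral {lo..hi} (\<lambda>x. of_real (\<psi> ((x - a) / s) / s) * w x))
      (of_real m * w a) < \<epsilon>"
    using eventually_at_right_less eventually_at_rightI[OF _ \<open>s0 > 0\<close>] main
    by (metis (no_types, lifting) greaterThanLessThan_iff)
qed

text \<open>The bridge between the Lebesgue integrals over the half line in the definitions and the
  gauge integrals over compact intervals used for the calculus.\<close>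

lemma lebesgue_integral_lebesgue_on_eq_integral:
  fixes f :: "'a::euclidean_space \<Rightarrow> 'b::euclidean_space"
  assumes "f absolutely_integrable_on T" "T \<subseteq> S" "S \<in> sets lebesgue" "\<And>x. x \<in> S \<Longrightarrow> x \<notin> T \<Longrightarrow> f x = 0"
  shows "integral\<^sup>L (lebesgue_on S) f = integral T f"
proof -
  have "integral\<^sup>L (lebesgue_on S) f = set_lebesgue_integral lebesgue S f"
    using assms(3) by (simp add: integral_restrict_space set_lebesgue_integral_def)
  also have "\<dots> = set_lebesgue_integral lebesgue T f"
    unfolding set_lebesgue_integral_def using assms(2,4)
    by (intro Bochner_Integration.integral_cong) (auto simp: indicator_def)
  finally show ?thesis
    using set_lebesgue_integral_eq_integral(2)[OF assms(1)] by simp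
qed

text \<open>
  The combination of three translates of the smoothed ramp \<open>\<Psi>\<close> is chosen so that its slope and its
  constant term cancel to the right of \<open>c\<close>; it is therefore a test function whose second derivative is
  an approximate identity at \<open>a\<close>, \<open>b\<close> and \<open>c\<close>.
\<close>

lemma weakly_affine_imp_affine:
  fixes w :: "real \<Rightarrow> complex"
  assumes w: "continuous_on {0<..} w"
    and weak: "\<And>\<phi>. \<phi> \<in> test_functions {0<..} \<Longrightarrow>
      integral\<^sup>L (lebesgue_on {0<..}) (\<lambda>r. w r * laplacian \<phi> r) = 0"
    and abc: "0 < a" "a < b" "b < c"
  shows "of_real (c - b) * w a - of_real (c - a) * w b + of_real (b - a) * w c = 0"
proof -
  obtain \<Psi> :: "real \<Rightarrow> complex" and A \<psi> :: "real \<Rightarrow> real" and m :: real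
    where ramp: "\<And>n. k_times_diff n \<Psi>"
    "\<And>x. (\<Psi> has_vector_derivative of_real (A x)) (at x)"
    "\<And>x. (A has_real_derivative \<psi> x) (at x)"
    "continuous_on UNIV \<psi>" "\<And>x. \<psi> x \<ge> 0" "\<And>x. \<bar>x\<bar> \<ge> 1 \<Longrightarrow> \<psi> x = 0"
    "\<And>x. x \<le> -1 \<Longrightarrow> A x = 0" "\<And>x. x \<ge> 1 \<Longrightarrow> A x = m" "m > 0"
    "\<And>x. x \<le> -1 \<Longrightarrow> \<Psi> x = 0" "\<And>x. x \<ge> 1 \<Longrightarrow> \<Psi> x = \<Psi> 1 + of_real (m * (x - 1))"
    by (rule smooth_ramp_exists) (rule that; assumption)
  define lo where "lo = a / 2"
  define hi where "hi = c + 1"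
  have lohi: "0 < lo" "lo < a" "c < hi" using abc by (auto simp: lo_def hi_def)
  \<comment> \<open>The weights of a second divided difference: p - q + t = 0 and p a - q b + t c =
    0, which is what annihilates affine functions.\<close>
  define p q t where "p = complex_of_real (c - b)" "q = complex_of_real (c - a)" "t = complex_of_real (b - a)"
  define J where "J y s = integral {lo..hi} (\<lambda>x. of_real (\<psi> ((x - y) / s) / s) * w x)" for y s
  have w': "continuous_on {lo..hi} w"
    using w lohi by (rule_tac continuous_on_subset) auto
  have lim: "((\<lambda>s. p * J a s - q * J b s + t * J c s) \<longlongrightarrow>
      p * (of_real m * w a) - q * (of_real m * w b) + t * (of_real m * w c)) (at_right 0)"
    unfolding J_def using abc lohi
    by (intro tendsto_intros approximate_identity[OF ramp(3-9) w']) auto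
  \<comment> \<open>Since \<open>lo\<close> is a/2 and \<open>hi\<close> is c + 1, this bound on
    \<open>s\<close> keeps all three bumps inside the interval.\<close>
  have zero: "p * J a s - q * J b s + t * J c s = 0" if s: "0 < s" "s < min lo 1" for s
  proof -
    define shift where "shift y x = \<Psi> (1 / s * x + - y / s)" for y x
    define \<phi> where "\<phi> x = p * shift a x + - q * shift b x + t * shift c x" for x
    have shift_eq: "shift y x = \<Psi> ((x - y) / s)" for y x
      by (simp add: shift_def diff_divide_distrib)
    have "k_times_diff n \<phi>" for n
      unfolding \<phi>_def shift_def
      by (intro k_times_diff_add k_times_diff_mult k_times_diff_const k_times_diff_affine_comp ramp(1))
    then have "smooth_fun \<phi>" by (rule smooth_fun_if_k_times_diff)
    moreover have "\<phi> x = 0" if "x \<notin> {lo..hi}" for x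
    proof (cases "x < lo")
      case True
      then have "shift y x = 0" if "y \<ge> a" for y
        unfolding shift_eq using s that by (intro ramp(10)) (auto simp: lo_def field_simps)
      then show ?thesis using abc by (simp add: \<phi>_def)
    next
      case False
      then have x: "x > hi" using that by auto
      have "shift y x = \<Psi> 1 + of_real (m * ((x - y) / s - 1))" if "y \<le> c" for y
        unfolding shift_eq using s x that by (intro ramp(11)) (auto simp: hi_def field_simps)
      then show ?thesis using abc s
        by (simp add: \<phi>_def p_q_t_def) (simp add: field_simps)
    qed
    ultimately have "\<phi> \<in> test_functions {0<..}"
      using lohi by (auto simp: test_functions_def intro!: exI[of _ "{lo..hi}"])
    note vanish = weak[OF this]
    define \<phi>'' where "\<phi>'' x = (p * of_real (\<psi> ((x - a) / s)) - q * of_real (\<psi> ((x - b) / s)) + t * of_real (\<psi> ((x - c) / s))) / of_real (s\<^sup>2)" for x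
    have "laplacian \<phi> x = \<phi>'' x" for x
    proof -
      have d1: "(shift y has_vector_derivative of_real (1 / s) * of_real (A (1 / s * x + - y / s))) (at x)" for y x
        unfolding shift_def by (rule has_vector_derivative_affine_comp[OF ramp(2)])
      have d1': "(\<phi> has_vector_derivative p * (of_real (1 / s) * of_real (A (1 / s * x + - a / s)))
         + - q * (of_real (1 / s) * of_real (A (1 / s * x + - b / s)))
         + t * (of_real (1 / s) * of_real (A (1 / s * x + - c / s)))) (at x)" for x
        unfolding \<phi>_def
        by (intro has_vector_derivative_add has_vector_derivative_mult_right d1)
      have d2: "((\<lambda>x. complex_of_real (A (1 / s * x + - y / s))) has_vector_derivative of_real (1 / s) * of_real (\<psi> (1 / s * x + - y / s))) (at x)" for y x
        by (rule has_vector_derivative_affine_comp[where f="\<lambda>x. complex_of_real (A x)"],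
            rule has_vector_derivative_of_real[unfolded o_def], rule ramp(3))
      have "pdiff 1 \<phi> = (\<lambda>x. p * (of_real (1 / s) * of_real (A (1 / s * x + - a / s)))
         + - q * (of_real (1 / s) * of_real (A (1 / s * x + - b / s)))
         + t * (of_real (1 / s) * of_real (A (1 / s * x + - c / s))))"
        using pdiff_eqI[OF d1'] by auto
      moreover have "((\<lambda>x. p * (of_real (1 / s) * of_real (A (1 / s * x + - a / s)))
         + - q * (of_real (1 / s) * of_real (A (1 / s * x + - b / s)))
         + t * (of_real (1 / s) * of_real (A (1 / s * x + - c / s)))) has_vector_derivative
          p * (of_real (1 / s) * (of_real (1 / s) * of_real (\<psi> (1 / s * x + - a / s))))
         + - q * (of_real (1 / s) * (of_real (1 / s) * of_real (\<psi> (1 / s * x + - b / s))))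
         + t * (of_real (1 / s) * (of_real (1 / s) * of_real (\<psi> (1 / s * x + - c / s))))) (at x)"
        by (intro has_vector_derivative_add has_vector_derivative_mult_right d2)
      ultimately show ?thesis
        unfolding laplacian_real \<phi>''_def using s
        by (simp add: pdiff_eqI diff_divide_distrib power2_eq_square) (simp add: field_simps)
    qed
    then have "integral\<^sup>L (lebesgue_on {0<..}) (\<lambda>r. w r * \<phi>'' r) = 0"
      using vanish by simp
    moreover have "integral\<^sup>L (lebesgue_on {0<..}) (\<lambda>r. w r * \<phi>'' r) = integral {lo..hi} (\<lambda>r. w r * \<phi>'' r)"
    proof (rule lebesgue_integral_lebesgue_on_eq_integral)
      show "(\<lambda>r. w r * \<phi>'' r) absolutely_integrable_on {lo..hi}"
        unfolding \<phi>''_def using s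
        by (intro absolutely_integrable_continuous_real continuous_intros w' continuous_on_compose2[OF ramp(4)]) auto
      fix x assume "x \<notin> {lo..hi}"
      then have "\<psi> ((x - y) / s) = 0" if "y \<in> {a..c}" for y
        using that s by (intro ramp(6)) (auto simp: lo_def hi_def field_simps)
      then show "w x * \<phi>'' x = 0" using abc by (simp add: \<phi>''_def)
    qed (use lohi in auto)
    \<comment> \<open>The second derivative of the rescaled ramp carries 1/s^2 while the kernel in
      \<open>J\<close> carries 1/s; the factor \<open>s\<close> restores the balance.\<close>
    moreover have "of_real s * integral {lo..hi} (\<lambda>r. w r * \<phi>'' r) = p * J a s - q * J b s + t * J c s"
    proof -
      have "((\<lambda>x. of_real (\<psi> ((x - y) / s) / s) * w x) has_integral J y s) {lo..hi}" for y
        unfolding J_def using s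
        by (intro integrable_integral integrable_continuous_interval continuous_intros w' continuous_on_compose2[OF ramp(4)]) auto
      then have "((\<lambda>x. p * (of_real (\<psi> ((x - a) / s) / s) * w x) - q * (of_real (\<psi> ((x - b) / s) / s) * w x)
          + t * (of_real (\<psi> ((x - c) / s) / s) * w x)) has_integral
          p * J a s - q * J b s + t * J c s) {lo..hi}"
        by (intro has_integral_add has_integral_diff has_integral_mult_right)
      moreover have "p * (of_real (\<psi> ((x - a) / s) / s) * w x) - q * (of_real (\<psi> ((x - b) / s) / s) * w x)
          + t * (of_real (\<psi> ((x - c) / s) / s) * w x) = of_real s * (w x * \<phi>'' x)" for x
        using s by (simp add: \<phi>''_def power2_eq_square field_simps)
      ultimately have "((\<lambda>x. of_real s * (w x * \<phi>'' x)) has_integral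
          p * J a s - q * J b s + t * J c s) {lo..hi}"
        by (simp only:)
      then show ?thesis
        using Henstock_Kurzweil_Integration.integral_mult_right integral_unique by metis
    qed
    ultimately show ?thesis by simp
  qed
  have ev: "\<forall>\<^sub>F s in at_right 0. 0 = p * J a s - q * J b s + t * J c s"
    using eventually_at_right_less zero lohi
    by (intro eventually_at_rightI[of 0 "min lo 1"]) auto
  have "((\<lambda>s. p * J a s - q * J b s + t * J c s) \<longlongrightarrow> 0) (at_right 0)"
    by (rule Lim_transform_eventually[OF tendsto_const ev])
  from tendsto_unique[OF _ lim this]
  have "of_real m * (p * w a - q * w b + t * w c) = 0"
    by (simp add: algebra_simps)
  then show ?thesis using ramp(9) by (simp add: p_q_t_def)
qed

section \<open>Indefinite integrals of bounded measurable functions\<close>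

text \<open>The bound holds at every point rather than almost everywhere, so that increments of
  primitives can be estimated pointwise.\<close>

definition bounded_measurable_on :: "real \<Rightarrow> real \<Rightarrow> (real \<Rightarrow> complex) \<Rightarrow> bool" where
  "bounded_measurable_on a b f \<longleftrightarrow>
     f \<in> borel_measurable (lebesgue_on {a..b}) \<and> (\<exists>K. \<forall>x\<in>{a..b}. norm (f x) \<le> K)"

text \<open>Absolute continuity with a bounded density. It is stated through the integral because a
  measurable density is the derivative only almost everywhere.\<close>

definition primitive_on :: "real \<Rightarrow> real \<Rightarrow> (real \<Rightarrow> complex) \<Rightarrow> (real \<Rightarrow> complex) \<Rightarrow> bool" where
  "primitive_on a b f U \<longleftrightarrow>
     bounded_measurable_on a b f \<and> (\<forall>x\<in>{a..b}. U x = U a + integral {a..x} f)"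

lemma bounded_measurable_on_continuous:
  assumes "continuous_on {a..b} f"
  shows "bounded_measurable_on a b f"
proof -
  have "bounded (f ` {a..b})"
    using assms by (intro compact_imp_bounded compact_continuous_image) simp_all
  then show ?thesis
    using continuous_imp_measurable_on_sets_lebesgue[OF assms]
    by (simp add: bounded_measurable_on_def bounded_iff)
qed

lemma bounded_measurable_on_add:
  assumes "bounded_measurable_on a b f" "bounded_measurable_on a b g"
  shows "bounded_measurable_on a b (\<lambda>x. f x + g x)"
proof -
  obtain K where K: "\<forall>x\<in>{a..b}. norm (f x) \<le> K"
    using assms(1) by (auto simp: bounded_measurable_on_def)
  obtain L where L: "\<forall>x\<in>{a..b}. norm (g x) \<le> L"
    using assms(2) by (auto simp: bounded_measurable_on_def)
  have "\<forall>x\<in>{a..b}. norm (f x + g x) \<le> K + L"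
    using K L by (intro ballI norm_triangle_le add_mono) auto
  then show ?thesis
    using assms borel_measurable_add unfolding bounded_measurable_on_def by blast
qed

lemma bounded_measurable_on_mult:
  assumes "bounded_measurable_on a b f" "bounded_measurable_on a b g"
  shows "bounded_measurable_on a b (\<lambda>x. f x * g x)"
proof -
  obtain K where K: "\<forall>x\<in>{a..b}. norm (f x) \<le> K"
    using assms(1) by (auto simp: bounded_measurable_on_def)
  obtain L where L: "\<forall>x\<in>{a..b}. norm (g x) \<le> L"
    using assms(2) by (auto simp: bounded_measurable_on_def)
  have "norm (f x * g x) \<le> K * L" if "x \<in> {a..b}" for x
    unfolding norm_mult using K[rule_format, OF that] L[rule_format, OF that]
    by (intro mult_mono order_trans[OF norm_ge_zero]) auto
  then show ?thesis
    using assms borel_measurable_times unfolding bounded_measurable_on_def by blast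
qed

lemma bounded_measurable_on_uminus:
  "bounded_measurable_on a b f \<Longrightarrow> bounded_measurable_on a b (\<lambda>x. - f x)"
  using bounded_measurable_on_mult[OF bounded_measurable_on_continuous[of a b "\<lambda>x. -1"]] by simp

lemma bounded_measurable_on_diff:
  assumes "bounded_measurable_on a b f" "bounded_measurable_on a b g"
  shows "bounded_measurable_on a b (\<lambda>x. f x - g x)"
  using bounded_measurable_on_add[OF assms(1) bounded_measurable_on_uminus[OF assms(2)]] by simp

lemma bounded_measurable_on_cnj:
  "bounded_measurable_on a b f \<Longrightarrow> bounded_measurable_on a b (\<lambda>x. cnj (f x))"
  unfolding bounded_measurable_on_def complex_mod_cnj
  using borel_measurable_continuous_on[of cnj] continuous_on_cnj[OF continuous_on_id]
  by blast

lemma bounded_measurable_on_subinterval: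
  assumes "bounded_measurable_on a b f" "a \<le> c" "d \<le> b"
  shows "bounded_measurable_on c d f"
proof -
  have "f \<in> borel_measurable (lebesgue_on {c..d})"
    using assms by (auto simp: bounded_measurable_on_def elim: measurable_restrict_mono)
  moreover obtain K where "\<forall>x\<in>{a..b}. norm (f x) \<le> K"
    using assms by (auto simp: bounded_measurable_on_def)
  then have "\<forall>x\<in>{c..d}. norm (f x) \<le> K" using assms by auto
  ultimately show ?thesis by (auto simp: bounded_measurable_on_def)
qed

lemma bounded_measurable_on_absolutely_integrable:
  assumes "bounded_measurable_on a b f"
  shows "f absolutely_integrable_on {a..b}"
proof -
  obtain K where "\<forall>x\<in>{a..b}. norm (f x) \<le> K"
    using assms by (auto simp: bounded_measurable_on_def)
  then show ?thesis
    using assms by (intro measurable_bounded_by_integrable_imp_absolutely_integrable[where g="\<lambda>x. K"])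
      (auto simp: bounded_measurable_on_def)
qed

lemma bounded_measurable_on_integrable:
  "bounded_measurable_on a b f \<Longrightarrow> f integrable_on {a..b}"
  using bounded_measurable_on_absolutely_integrable set_lebesgue_integral_eq_integral(1) by blast

lemma primitive_onD:
  "primitive_on a b f U \<Longrightarrow> x \<in> {a..b} \<Longrightarrow> U x = U a + integral {a..x} f"
  unfolding primitive_on_def by blast

lemma primitive_on_diff_eq_integral:
  assumes "primitive_on a b f U" "a \<le> s" "s \<le> t" "t \<le> b"
  shows "U t - U s = integral {s..t} f"
proof -
  have "bounded_measurable_on a t f"
    using assms by (auto simp: primitive_on_def intro: bounded_measurable_on_subinterval)
  then have "integral {a..s} f + integral {s..t} f = integral {a..t} f"
    using assms by (intro Henstock_Kurzweil_Integration.integral_combine bounded_measurable_on_integrable)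
  moreover have "U t = U a + integral {a..t} f" "U s = U a + integral {a..s} f"
    using assms by (auto intro!: primitive_onD)
  ultimately show ?thesis by (simp add: algebra_simps)
qed

lemma primitive_on_bounded_measurable: "primitive_on a b f U \<Longrightarrow> bounded_measurable_on a b f"
  by (simp add: primitive_on_def)

lemma primitive_on_lipschitz:
  assumes U: "primitive_on a b f U" and K: "\<forall>x\<in>{a..b}. norm (f x) \<le> K"
    and st: "s \<in> {a..b}" "t \<in> {a..b}"
  shows "norm (U t - U s) \<le> K * \<bar>t - s\<bar>"
proof -
  have "K \<ge> 0" using K st(1) norm_ge_zero order_trans by blast
  have *: "norm (U t - U s) \<le> K * (t - s)" if "a \<le> s" "s \<le> t" "t \<le> b" for s t
  proof -
    have "bounded_measurable_on s t f"
      using U that primitive_on_bounded_measurable bounded_measurable_on_subinterval by blast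
    then have "(f has_integral (U t - U s)) (cbox s t)"
      unfolding primitive_on_diff_eq_integral[OF U that]
      by (simp add: bounded_measurable_on_integrable integrable_integral)
    from has_integral_bound[OF \<open>K \<ge> 0\<close> this] show ?thesis
      using K that by auto
  qed
  show ?thesis using *[of s t] *[of t s] st by (cases "s \<le> t") (auto simp: norm_minus_commute)
qed

lemma primitive_on_continuous_on:
  assumes "primitive_on a b f U"
  shows "continuous_on {a..b} U"
proof -
  have "continuous_on {a..b} (\<lambda>x. U a + integral {a..x} f)"
    using assms by (intro continuous_intros indefinite_integral_continuous_1
        bounded_measurable_on_integrable primitive_on_bounded_measurable)
  then show ?thesis
    by (rule continuous_on_eq) (rule primitive_onD[OF assms, symmetric])
qed

text \<open>The fundamental theorem of calculus; the finite exceptional set accommodates the kink of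
  the ramp.\<close>

lemma primitive_on_if_derivative:
  assumes "bounded_measurable_on a b f" "continuous_on {a..b} U" "finite S"
    and "\<And>x. x \<in> {a..b} - S \<Longrightarrow> (U has_vector_derivative f x) (at x)"
  shows "primitive_on a b f U"
  unfolding primitive_on_def
proof (intro conjI ballI assms(1))
  fix x assume x: "x \<in> {a..b}"
  have "(f has_integral U x - U a) {a..x}"
    using x assms
    by (intro fundamental_theorem_of_calculus_strong[where S=S])
      (auto intro: has_vector_derivative_at_within continuous_on_subset)
  then show "U x = U a + integral {a..x} f" by (simp add: integral_unique)
qed

lemma primitive_on_has_vector_derivative:
  assumes U: "primitive_on a b f U" and f: "continuous_on {a..b} f" and x: "a < x" "x < b"
  shows "(U has_vector_derivative f x) (at x)"
proof -
  have "((\<lambda>u. U a + integral {a..u} f) has_vector_derivative 0 + f x) (at x within {a..b})"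
    using x f by (intro has_vector_derivative_add integral_has_vector_derivative) auto
  then have "((\<lambda>u. U a + integral {a..u} f) has_vector_derivative f x) (at x)"
    using x by (simp add: at_within_Icc_at)
  then show ?thesis
    by (rule has_vector_derivative_transform_within_open[where S="{a<..<b}"])
      (use x in \<open>auto intro!: primitive_onD[OF U, symmetric]\<close>)
qed

lemma primitive_on_add:
  assumes "primitive_on a b f U" "primitive_on a b g V"
  shows "primitive_on a b (\<lambda>x. f x + g x) (\<lambda>x. U x + V x)"
  unfolding primitive_on_def
proof (intro conjI ballI)
  show "bounded_measurable_on a b (\<lambda>x. f x + g x)"
    using assms by (intro bounded_measurable_on_add primitive_on_bounded_measurable)
  fix x assume x: "x \<in> {a..b}"
  have "f integrable_on {a..x}" "g integrable_on {a..x}"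
    using assms[THEN primitive_on_bounded_measurable] x
    by (auto intro!: bounded_measurable_on_integrable elim: bounded_measurable_on_subinterval)
  then have "integral {a..x} (\<lambda>x. f x + g x) = integral {a..x} f + integral {a..x} g"
    by (rule Henstock_Kurzweil_Integration.integral_add)
  moreover have "U x = U a + integral {a..x} f" "V x = V a + integral {a..x} g"
    using assms x by (auto intro!: primitive_onD)
  ultimately show "U x + V x = U a + V a + integral {a..x} (\<lambda>x. f x + g x)"
    by (simp add: algebra_simps)
qed

text \<open>The difference quotients are at most \<open>K\<close> times the step, so the derivative
  is 0 at every point.\<close>

lemma constant_if_quadratic_increments:
  fixes H :: "real \<Rightarrow> complex"
  assumes "\<And>s t. s \<in> {a..b} \<Longrightarrow> t \<in> {a..b} \<Longrightarrow> norm (H t - H s) \<le> K * \<bar>t - s\<bar>\<^sup>2"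
    and "x \<in> {a..b}"
  shows "H x = H a"
proof (rule has_derivative_zero_unique[where f=H and s="{a..b}"])
  fix y assume y: "y \<in> {a..b}"
  have "((\<lambda>x. norm (H x - H y) / norm (x - y)) \<longlongrightarrow> 0) (at y within {a..b})"
  proof (rule tendsto_sandwich[where f="\<lambda>_. 0"])
    show "((\<lambda>x. K * \<bar>x - y\<bar>) \<longlongrightarrow> 0) (at y within {a..b})"
      by (rule tendsto_eq_intros refl | simp)+
    show "\<forall>\<^sub>F x in at y within {a..b}. norm (H x - H y) / norm (x - y) \<le> K * \<bar>x - y\<bar>"
      unfolding eventually_at_filter
      using assms(1)[OF y] by (auto simp: field_simps power2_eq_square intro!: always_eventually)
  qed auto
  then show "(H has_derivative (\<lambda>h. 0)) (at y within {a..b})"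
    by (simp add: has_derivative_iff_norm)
qed (use assms in auto)

text \<open>
  The densities are only measurable, so \<open>U\<close> and \<open>V\<close> need not be differentiable everywhere; instead
  the defect of the product rule has increments of order \<open>|t - s|\<^sup>2\<close>, hence is constant.
\<close>

lemma primitive_on_mult:
  assumes U: "primitive_on a b f U" and V: "primitive_on a b g V"
  shows "primitive_on a b (\<lambda>x. f x * V x + U x * g x) (\<lambda>x. U x * V x)"
  unfolding primitive_on_def
proof (intro conjI ballI)
  define h where "h x = f x * V x + U x * g x" for x
  have h: "bounded_measurable_on a b h"
    unfolding h_def using assms
    by (intro bounded_measurable_on_add bounded_measurable_on_mult bounded_measurable_on_continuous
        primitive_on_continuous_on primitive_on_bounded_measurable)
  then show "bounded_measurable_on a b (\<lambda>x. f x * V x + U x * g x)"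
    by (simp add: h_def[abs_def])
  fix x assume x: "x \<in> {a..b}"
  obtain K where K: "\<forall>x\<in>{a..b}. norm (f x) \<le> K"
    using primitive_on_bounded_measurable[OF U] by (auto simp: bounded_measurable_on_def)
  obtain L where L: "\<forall>x\<in>{a..b}. norm (g x) \<le> L"
    using primitive_on_bounded_measurable[OF V] by (auto simp: bounded_measurable_on_def)
  have KL: "K \<ge> 0" "L \<ge> 0"
    using K[rule_format, OF x] L[rule_format, OF x] norm_ge_zero order_trans by blast+
  define H where "H x = U x * V x - integral {a..x} h" for x
  have incr: "norm (H t - H s) \<le> (2 * K * L) * (t - s)\<^sup>2" if st: "a \<le> s" "s \<le> t" "t \<le> b" for s t
  proof -
    have sub: "f integrable_on {s..t}" "g integrable_on {s..t}" "h integrable_on {s..t}"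
      using U[THEN primitive_on_bounded_measurable] V[THEN primitive_on_bounded_measurable] h st
      by (auto intro!: bounded_measurable_on_integrable elim: bounded_measurable_on_subinterval)
    have "h integrable_on {a..t}"
      using h st by (auto intro!: bounded_measurable_on_integrable elim: bounded_measurable_on_subinterval)
    then have "integral {a..s} h + integral {s..t} h = integral {a..t} h"
      using st by (intro Henstock_Kurzweil_Integration.integral_combine) auto
    then have "H t - H s = U t * V t - U s * V s - integral {s..t} h"
      by (simp add: H_def algebra_simps)
    \<comment> \<open>Freezing \<open>V\<close> at the right end and \<open>U\<close> at the left
      end pairs each density with an increment of the other function, which is itself of order t -
      s.\<close>
    also have "\<dots> = (U t - U s) * V t + U s * (V t - V s) - integral {s..t} h"
      by (simp add: algebra_simps)
    also have "\<dots> = integral {s..t} f * V t + U s * integral {s..t} g - integral {s..t} h"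
      using primitive_on_diff_eq_integral[OF U st] primitive_on_diff_eq_integral[OF V st] by simp
    also have "((\<lambda>x. f x * V t + U s * g x - h x) has_integral \<dots>) {s..t}"
      using sub by (intro has_integral_diff has_integral_add has_integral_mult_left
          has_integral_mult_right integrable_integral)
    finally have int: "((\<lambda>x. f x * (V t - V x) + (U s - U x) * g x) has_integral (H t - H s)) {s..t}"
      by (simp add: h_def algebra_simps)
    have "norm (f y * (V t - V y) + (U s - U y) * g y) \<le> 2 * K * L * (t - s)" if y: "y \<in> {s..t}" for y
    proof -
      have "norm (V t - V y) \<le> L * \<bar>t - y\<bar>"
        using y st by (intro primitive_on_lipschitz[OF V L]) auto
      also have "\<dots> \<le> L * (t - s)" using y KL by (intro mult_left_mono) auto
      finally have "norm (V t - V y) \<le> L * (t - s)" .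
      moreover have "norm (U s - U y) \<le> K * \<bar>s - y\<bar>"
        using y st by (intro primitive_on_lipschitz[OF U K]) auto
      then have "norm (U s - U y) \<le> K * (t - s)"
        by (rule order_trans) (use y KL in \<open>intro mult_left_mono, auto\<close>)
      moreover have "norm (f y) \<le> K" "norm (g y) \<le> L" using K L y st by auto
      ultimately have "norm (f y) * norm (V t - V y) \<le> K * (L * (t - s))"
        "norm (U s - U y) * norm (g y) \<le> (K * (t - s)) * L"
        using KL st by (auto intro!: mult_mono)
      then have "norm (f y * (V t - V y)) + norm ((U s - U y) * g y) \<le> 2 * K * L * (t - s)"
        unfolding norm_mult by (simp add: algebra_simps)
      then show ?thesis by (rule norm_triangle_le)
    qed
    then have "norm (H t - H s) \<le> 2 * K * L * (t - s) * (t - s)"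
      using has_integral_bound[OF _ int[folded cbox_interval], of "2 * K * L * (t - s)"] KL st by simp
    then show ?thesis by (simp add: power2_eq_square mult.assoc)
  qed
  have "H x = H a"
  proof (rule constant_if_quadratic_increments[OF _ x])
    fix s t assume "s \<in> {a..b}" "t \<in> {a..b}"
    then show "norm (H t - H s) \<le> (2 * K * L) * \<bar>t - s\<bar>\<^sup>2"
      using incr[of s t] incr[of t s]
      by (cases "s \<le> t") (auto simp: norm_minus_commute power2_commute)
  qed
  then show "U x * V x = U a * V a + integral {a..x} (\<lambda>x. f x * V x + U x * g x)"
    unfolding H_def by (simp add: h_def[abs_def] algebra_simps)
qed

text \<open>One primitive serves all intervals at once. It is based at 1 because the density may be
  singular at 0; the two terms form an oriented integral, since the integral over an empty interval
  is 0.\<close>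

lemma primitive_exists_pos:
  assumes "\<And>a b. 0 < a \<Longrightarrow> bounded_measurable_on a b f"
  obtains F where "\<And>a b. 0 < a \<Longrightarrow> primitive_on a b f F"
proof -
  define F where "F x = integral {1..x} f - integral {x..1} f" for x
  have comb: "integral {s..t} f + integral {t..r} f = integral {s..r} f" if "0 < s" "s \<le> t" "t \<le> r" for s t r
    using that assms by (intro Henstock_Kurzweil_Integration.integral_combine bounded_measurable_on_integrable) auto
  have "F x = F a + integral {a..x} f" if "0 < a" "a \<le> x" for a x
  proof -
    consider "1 \<le> a" | "a \<le> 1" "1 \<le> x" | "x \<le> 1" by linarith
    then show ?thesis
    proof cases
      case 1
      then have "integral {a..1} f = 0" "integral {x..1} f = 0"
        using that by (cases "a = 1"; cases "x = 1"; auto)+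
      then show ?thesis using comb[of 1 a x] 1 that by (simp add: F_def algebra_simps)
    next
      case 2
      then have "integral {1..a} f = 0" "integral {x..1} f = 0"
        using that by (cases "a = 1"; cases "x = 1"; auto)+
      then show ?thesis using comb[of a 1 x] 2 that by (simp add: F_def algebra_simps)
    next
      case 3
      then have "integral {1..a} f = 0" "integral {1..x} f = 0"
        using that by (cases "a = 1"; cases "x = 1"; auto)+
      then show ?thesis using comb[of a x 1] 3 that by (simp add: F_def algebra_simps)
    qed
  qed
  then have "primitive_on a b f F" if "0 < a" for a b
    unfolding primitive_on_def using assms[OF that, of b] that by (meson atLeastAtMost_iff)
  then show ?thesis by (rule that)
qed

section \<open>Distributional Green functions on the half line\<close>

lemma pdiff_eq_0_outside:
  assumes "\<And>x. x \<notin> {lo..hi} \<Longrightarrow> f x = 0" "x \<notin> {lo..hi}"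
  shows "pdiff (1::real) f x = 0"
proof (rule pdiff_eqI)
  have "((\<lambda>x. 0::complex) has_vector_derivative 0) (at x)" by simp
  then show "(f has_vector_derivative 0) (at x)"
    by (rule has_vector_derivative_transform_within_open[where S="- {lo..hi}"])
      (use assms in auto)
qed

text \<open>The interval extends strictly beyond the support, so that \<open>\<phi>\<close> and its
  derivative vanish at the end points and integration by parts leaves no boundary terms. It is made
  to contain \<open>s\<close>, where the delta sits.\<close>

lemma test_function_support:
  fixes \<phi> :: "real \<Rightarrow> complex"
  assumes "\<phi> \<in> test_functions {0<..}" "s > 0"
  obtains a b where "0 < a" "a < s" "s < b"
    "\<And>x. x \<notin> {a<..<b} \<Longrightarrow> \<phi> x = 0"
    "\<And>x. x \<notin> {a<..<b} \<Longrightarrow> pdiff 1 \<phi> x = 0"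
    "\<And>x. x \<notin> {a<..<b} \<Longrightarrow> laplacian \<phi> x = 0"
proof -
  obtain K where K: "compact K" "K \<subseteq> {0<..}" "\<And>x. x \<notin> K \<Longrightarrow> \<phi> x = 0"
    using assms(1) by (auto simp: test_functions_def)
  have K': "compact (insert s K)" "insert s K \<noteq> {}" using K(1) by auto
  obtain lo where lo: "lo \<in> insert s K" "\<And>x. x \<in> insert s K \<Longrightarrow> lo \<le> x"
    using compact_attains_inf[OF K'] by blast
  obtain hi where hi: "\<And>x. x \<in> insert s K \<Longrightarrow> x \<le> hi"
    using compact_attains_sup[OF K'] by blast
  have out: "\<phi> x = 0" if "x \<notin> {lo..hi}" for x
    using K(3)[of x] lo(2)[of x] hi[of x] that by auto
  have out': "pdiff 1 \<phi> x = 0" if "x \<notin> {lo..hi}" for x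
    using pdiff_eq_0_outside[OF out that] by simp
  have out'': "laplacian \<phi> x = 0" if "x \<notin> {lo..hi}" for x
    unfolding laplacian_real using pdiff_eq_0_outside[OF out' that] by simp
  have lo_pos: "lo > 0" using lo(1) K(2) assms(2) by auto
  have "lo \<le> s" "s \<le> hi" using lo(2) hi by auto
  then have ends: "0 < lo / 2" "lo / 2 < s" "s < hi + 1" using lo_pos by auto
  have sub: "x \<notin> {lo..hi}" if "x \<notin> {lo/2<..<hi+1}" for x using that lo_pos by auto
  show ?thesis
    by (rule that[OF ends]) (erule out[OF sub] out'[OF sub] out''[OF sub])+
qed

text \<open>One column of a Green function for -u'' + q u, detached from the radial operator so that
  \<open>q\<close> can be conjugated or changed on a null set.\<close>

definition weak_green :: "(real \<Rightarrow> complex) \<Rightarrow> real \<Rightarrow> (real \<Rightarrow> complex) \<Rightarrow> bool" where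
  "weak_green q s u \<longleftrightarrow> continuous_on {0<..} u \<and>
     (\<forall>\<phi> \<in> test_functions {0<..}.
        (LINT r|lebesgue_on {0<..}. u r * (- laplacian \<phi> r + q r * \<phi> r)) = \<phi> s)"

lemma affine_on_pos:
  fixes w :: "real \<Rightarrow> complex"
  assumes "\<And>a b c. 0 < a \<Longrightarrow> a < b \<Longrightarrow> b < c \<Longrightarrow>
    of_real (c - b) * w a - of_real (c - a) * w b + of_real (b - a) * w c = 0"
    and "x > 0"
  shows "w x = w 1 + of_real (x - 1) * (w 2 - w 1)"
proof -
  consider "x < 1" | "x = 1" | "1 < x" "x < 2" | "x = 2" | "2 < x" by linarith
  then show ?thesis
  proof cases
    case 1
    then show ?thesis using assms(1)[of x 1 2] assms(2) by (simp add: algebra_simps)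
  next
    case 3
    then show ?thesis using assms(1)[of 1 x 2] by (simp add: algebra_simps)
  next
    case 5
    then show ?thesis using assms(1)[of 1 2 x] by (simp add: algebra_simps)
  qed auto
qed

lemma ramp_has_vector_derivative:
  assumes "x \<noteq> s"
  shows "((\<lambda>x. complex_of_real (max 0 (x - s))) has_vector_derivative (if x > s then 1 else 0)) (at x)"
proof (cases "x > s")
  case True
  have "((\<lambda>x. complex_of_real (x - s)) has_vector_derivative of_real 1) (at x)"
    by (intro has_vector_derivative_of_real[unfolded o_def]) (auto intro!: derivative_eq_intros)
  then have "((\<lambda>x. complex_of_real (max 0 (x - s))) has_vector_derivative of_real 1) (at x)"
    by (rule has_vector_derivative_transform_within_open[where S="{s<..}"]) (use True in auto)
  with True show ?thesis by simp
next
  case False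
  have "((\<lambda>x. 0::complex) has_vector_derivative 0) (at x)" by simp
  then have "((\<lambda>x. complex_of_real (max 0 (x - s))) has_vector_derivative 0) (at x)"
    by (rule has_vector_derivative_transform_within_open[where S="{..<s}"]) (use False assms in auto)
  with False show ?thesis by simp
qed

lemma bounded_measurable_on_step: "bounded_measurable_on a b (\<lambda>x. if x > s then 1 else 0)"
proof -
  have "(\<lambda>x. indicator {s<..} x :: complex) \<in> borel_measurable borel" by measurable
  then have "(\<lambda>x. indicator {s<..} x :: complex) \<in> borel_measurable (lebesgue_on {a..b})"
    by (intro borel_measurable_if_lebesgue_on measurable_restrict_space1 measurable_completion) auto
  moreover have "(\<lambda>x. indicator {s<..} x :: complex) = (\<lambda>x. if x > s then 1 else 0)"
    by (auto simp: indicator_def)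
  ultimately show ?thesis
    by (auto simp: bounded_measurable_on_def intro!: exI[of _ 1])
qed

lemma primitive_on_ramp:
  "primitive_on a b (\<lambda>x. if x > s then 1 else 0) (\<lambda>x. complex_of_real (max 0 (x - s)))"
  by (intro primitive_on_if_derivative[where S="{s}"] bounded_measurable_on_step
      ramp_has_vector_derivative continuous_intros) auto

text \<open>Adding the ramp \<open>(x - s)\<^sub>+\<close> removes the jump of the derivative produced by \<open>\<delta>\<^sub>s\<close>.\<close>

lemma weak_green_regular:
  assumes wg: "weak_green q s u" and s: "s > 0"
    and q: "\<And>a b. 0 < a \<Longrightarrow> bounded_measurable_on a b q"
  obtains D where "\<And>a b. 0 < a \<Longrightarrow> primitive_on a b (\<lambda>x. q x * u x) D"
    and "\<And>x. x > 0 \<Longrightarrow> ((\<lambda>x. u x + of_real (max 0 (x - s))) has_vector_derivative D x) (at x)"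
proof -
  have u: "continuous_on {a..b} u" if "0 < a" for a b
    using wg that unfolding weak_green_def by (auto elim: continuous_on_subset)
  have qu: "bounded_measurable_on a b (\<lambda>x. q x * u x)" if "0 < a" for a b
    using that by (intro bounded_measurable_on_mult q bounded_measurable_on_continuous u)
  obtain p where p: "\<And>a b. 0 < a \<Longrightarrow> primitive_on a b (\<lambda>x. q x * u x) p"
    using primitive_exists_pos[OF qu] by blast
  have p_cont: "continuous_on {a..b} p" if "0 < a" for a b
    using primitive_on_continuous_on[OF p[OF that]] .
  obtain z where z: "\<And>a b. 0 < a \<Longrightarrow> primitive_on a b p z"
    using primitive_exists_pos[OF bounded_measurable_on_continuous[OF p_cont]] by blast
  have dz: "(z has_vector_derivative p x) (at x)" if "x > 0" for x
    using that by (intro primitive_on_has_vector_derivative[OF z[of "x/2" "x+1"] p_cont]) auto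
  have z_cont: "continuous_on {0<..} z"
    using dz by (auto intro!: continuous_at_imp_continuous_on has_vector_derivative_continuous)
  define \<rho> where "\<rho> x = complex_of_real (max 0 (x - s))" for x
  define H :: "real \<Rightarrow> complex" where "H x = (if x > s then 1 else 0)" for x
  have \<rho>: "primitive_on a b H \<rho>" for a b
    unfolding \<rho>_def[abs_def] H_def[abs_def] by (rule primitive_on_ramp)
  have \<rho>_cont: "continuous_on T \<rho>" for T
    unfolding \<rho>_def by (intro continuous_intros)
  \<comment> \<open>distributionally \<open>z'' = q u\<close> and \<open>\<rho>'' = \<delta>\<^sub>s\<close>, so \<open>w''\<close> vanishes\<close>
  define w where "w x = z x - u x - \<rho> x" for x
  have w_cont: "continuous_on {0<..} w"
    using wg z_cont unfolding w_def weak_green_def by (auto intro!: continuous_intros \<rho>_cont)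
  have weak: "(LINT r|lebesgue_on {0<..}. w r * laplacian \<phi> r) = 0"
    if \<phi>: "\<phi> \<in> test_functions {0<..}" for \<phi>
  proof -
    obtain a b where ab: "0 < a" "a < s" "s < b"
      and out: "\<And>x. x \<notin> {a<..<b} \<Longrightarrow> \<phi> x = 0"
        "\<And>x. x \<notin> {a<..<b} \<Longrightarrow> pdiff 1 \<phi> x = 0"
        "\<And>x. x \<notin> {a<..<b} \<Longrightarrow> laplacian \<phi> x = 0"
      using test_function_support[OF \<phi> s] by blast
    define \<phi>' where "\<phi>' = pdiff 1 \<phi>"
    define \<phi>'' where "\<phi>'' = laplacian \<phi>"
    have out_ends: "\<phi> a = 0" "\<phi> b = 0" "\<phi>' a = 0" "\<phi>' b = 0"
      using out(1,2)[of a] out(1,2)[of b] ab by (auto simp: \<phi>'_def)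
    have sm: "smooth_fun \<phi>" "smooth_fun (pdiff 1 \<phi>)" "smooth_fun (pdiff 1 (pdiff 1 \<phi>))"
      using \<phi> by (auto simp: test_functions_def intro!: smooth_fun_pdiff)
    have lap: "\<phi>'' = pdiff 1 (pdiff 1 \<phi>)"
      by (auto simp: \<phi>''_def laplacian_real)
    have cont: "continuous_on T \<phi>" "continuous_on T \<phi>'" "continuous_on T \<phi>''" for T
      unfolding \<phi>'_def lap using sm by (auto intro: smooth_fun_continuous_on)
    have prim: "primitive_on a b \<phi>' \<phi>" "primitive_on a b \<phi>'' \<phi>'"
      unfolding lap \<phi>'_def using sm
      by (auto intro!: primitive_on_if_derivative[where S="{}"] bounded_measurable_on_continuous
          smooth_fun_continuous_on smooth_fun_has_vector_derivative)
    have by_parts: "integral {a..b} (\<lambda>x. f x * V x + U x * g x) = 0"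
      if "primitive_on a b f U" "primitive_on a b g V" "U a = 0" "U b = 0" for f g U V
      using primitive_onD[OF primitive_on_mult[OF that(1,2)], of b] that(3,4) ab by simp
    have ints: "(\<lambda>x. \<phi>' x * p x) integrable_on {a..b}" "(\<lambda>x. \<phi> x * (q x * u x)) integrable_on {a..b}"
      "(\<lambda>x. \<phi>'' x * z x) integrable_on {a..b}" "(\<lambda>x. \<phi>'' x * \<rho> x) integrable_on {a..b}"
      "(\<lambda>x. \<phi>' x * H x) integrable_on {a..b}" "(\<lambda>x. \<phi>'' x * u x) integrable_on {a..b}"
      using ab by (intro bounded_measurable_on_integrable bounded_measurable_on_mult
          bounded_measurable_on_continuous cont p_cont q u continuous_on_subset[OF z_cont] \<rho>_cont
          primitive_on_bounded_measurable[OF \<rho>]; auto)+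
    \<comment> \<open>By \<open>e1\<close> and \<open>e2\<close>, \<open>z\<close> tested against
      \<open>\<phi>''\<close> gives the integral of \<phi> q u; by \<open>e3\<close> and
      \<open>e4\<close> the ramp gives \<phi>(s). The weak equation \<open>e5\<close> says that the
      first minus the contribution of \<open>u\<close> equals the second.\<close>
    have e1: "integral {a..b} (\<lambda>x. \<phi>' x * p x) + integral {a..b} (\<lambda>x. \<phi> x * (q x * u x)) = 0"
      using by_parts[OF prim(1) p[OF ab(1)]] out_ends ints
      by (simp add: Henstock_Kurzweil_Integration.integral_add)
    have e2: "integral {a..b} (\<lambda>x. \<phi>'' x * z x) + integral {a..b} (\<lambda>x. \<phi>' x * p x) = 0"
      using by_parts[OF prim(2) z[OF ab(1)]] out_ends ints
      by (simp add: Henstock_Kurzweil_Integration.integral_add)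
    have e3: "integral {a..b} (\<lambda>x. \<phi>'' x * \<rho> x) + integral {a..b} (\<lambda>x. \<phi>' x * H x) = 0"
      using by_parts[OF prim(2) \<rho>] out_ends ints
      by (simp add: Henstock_Kurzweil_Integration.integral_add)
    have e4: "integral {a..b} (\<lambda>x. \<phi>' x * H x) = - \<phi> s"
    proof -
      have "integral {a..b} (\<lambda>x. \<phi>' x * H x)
          = integral {a..s} (\<lambda>x. \<phi>' x * H x) + integral {s..b} (\<lambda>x. \<phi>' x * H x)"
        using ab ints(5) by (intro Henstock_Kurzweil_Integration.integral_combine[symmetric]) auto
      also have "integral {a..s} (\<lambda>x. \<phi>' x * H x) = integral {a..s} (\<lambda>x. 0)"
        by (rule Henstock_Kurzweil_Integration.integral_cong) (auto simp: H_def)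
      also have "integral {s..b} (\<lambda>x. \<phi>' x * H x) = integral {s..b} \<phi>'"
        by (rule integral_spike[of "{s}"]) (auto simp: H_def)
      also have "\<dots> = \<phi> b - \<phi> s"
        using ab by (intro primitive_on_diff_eq_integral[OF prim(1), symmetric]) auto
      finally show ?thesis using out_ends by simp
    qed
    have "\<phi> s = (LINT r|lebesgue_on {0<..}. u r * (- laplacian \<phi> r + q r * \<phi> r))"
      using wg \<phi> by (simp add: weak_green_def)
    also have "\<dots> = integral {a..b} (\<lambda>r. u r * (- \<phi>'' r + q r * \<phi> r))"
      unfolding \<phi>''_def[symmetric]
    proof (rule lebesgue_integral_lebesgue_on_eq_integral)
      show "(\<lambda>r. u r * (- \<phi>'' r + q r * \<phi> r)) absolutely_integrable_on {a..b}"
        using ab by (intro bounded_measurable_on_absolutely_integrable bounded_measurable_on_mult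
            bounded_measurable_on_add bounded_measurable_on_uminus
            bounded_measurable_on_continuous cont q u)
    qed (use ab out in \<open>auto simp: \<phi>''_def\<close>)
    also have "\<dots> = integral {a..b} (\<lambda>x. \<phi> x * (q x * u x) - \<phi>'' x * u x)"
      by (simp add: algebra_simps)
    also have "\<dots> = integral {a..b} (\<lambda>x. \<phi> x * (q x * u x)) - integral {a..b} (\<lambda>x. \<phi>'' x * u x)"
      using ints by (simp add: Henstock_Kurzweil_Integration.integral_diff)
    finally have e5: "\<phi> s = \<dots>" .
    have "(LINT r|lebesgue_on {0<..}. w r * laplacian \<phi> r) = integral {a..b} (\<lambda>r. w r * \<phi>'' r)"
      unfolding \<phi>''_def[symmetric]
    proof (rule lebesgue_integral_lebesgue_on_eq_integral)
      show "(\<lambda>r. w r * \<phi>'' r) absolutely_integrable_on {a..b}"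
        using ab by (intro absolutely_integrable_continuous_real continuous_intros cont
            continuous_on_subset[OF w_cont]) auto
    qed (use ab out in \<open>auto simp: \<phi>''_def\<close>)
    also have "\<dots> = integral {a..b} (\<lambda>x. \<phi>'' x * z x - \<phi>'' x * u x - \<phi>'' x * \<rho> x)"
      by (simp add: w_def algebra_simps)
    also have "\<dots> = integral {a..b} (\<lambda>x. \<phi>'' x * z x) - integral {a..b} (\<lambda>x. \<phi>'' x * u x)
        - integral {a..b} (\<lambda>x. \<phi>'' x * \<rho> x)"
      using ints by (simp add: Henstock_Kurzweil_Integration.integral_diff integrable_diff)
    also have "\<dots> = 0" using e1 e2 e3 e4 e5 by (simp add: algebra_simps add_eq_0_iff)
    finally show ?thesis .
  qed
  have affine: "w x = w 1 + of_real (x - 1) * (w 2 - w 1)" if "x > 0" for x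
    by (rule affine_on_pos[OF weakly_affine_imp_affine[OF w_cont weak] that])
  define B where "B = w 2 - w 1"
  show ?thesis
  \<comment> \<open>On the half line u + \<rho> = z - w with \<open>w\<close> affine of slope
    \<open>B\<close>, hence the derivative p - B.\<close>
  proof (rule that[of "\<lambda>x. p x - B"])
    show "primitive_on a b (\<lambda>x. q x * u x) (\<lambda>x. p x - B)" if "0 < a" for a b
    proof -
      have "primitive_on a b (\<lambda>x. 0) (\<lambda>x. - B)"
        by (rule primitive_on_if_derivative[where S="{}"])
          (auto intro!: bounded_measurable_on_continuous)
      from primitive_on_add[OF p[OF that] this] show ?thesis by simp
    qed
    fix x :: real assume x: "x > 0"
    have "((\<lambda>x. z x - (w 1 + of_real (x - 1) * B)) has_vector_derivative p x - (0 + of_real 1 * B)) (at x)"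
      by (intro derivative_intros dz x has_vector_derivative_of_real[unfolded o_def])
        (auto intro!: derivative_eq_intros)
    then have "((\<lambda>x. z x - (w 1 + of_real (x - 1) * B)) has_vector_derivative p x - B) (at x)"
      by simp
    then show "((\<lambda>x. u x + of_real (max 0 (x - s))) has_vector_derivative p x - B) (at x)"
    proof (rule has_vector_derivative_transform_within_open[where S="{0<..}"])
      fix y :: real assume "y \<in> {0<..}"
      then show "z y - (w 1 + of_real (y - 1) * B) = u y + of_real (max 0 (y - s))"
        using affine[of y] by (simp add: w_def \<rho>_def B_def algebra_simps)
    qed (use x in auto)
  qed
qed

text \<open>
  To the right of \<open>s\<close> and \<open>t\<close> the derivatives of \<open>u1\<close>, \<open>u2\<close> are \<open>D1 - 1\<close>, \<open>D2 - 1\<close>, to the left they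
  are \<open>D1\<close>, \<open>D2\<close>; so the left-hand side is a difference of Wronskians.
\<close>

lemma green_identity:
  assumes w1: "weak_green q1 s u1" and w2: "weak_green q2 t u2"
    and p1: "primitive_on a b (\<lambda>x. q1 x * u1 x) D1" and p2: "primitive_on a b (\<lambda>x. q2 x * u2 x) D2"
    and d1: "\<And>x. x > 0 \<Longrightarrow> ((\<lambda>x. u1 x + of_real (max 0 (x - s))) has_vector_derivative D1 x) (at x)"
    and d2: "\<And>x. x > 0 \<Longrightarrow> ((\<lambda>x. u2 x + of_real (max 0 (x - t))) has_vector_derivative D2 x) (at x)"
    and ab: "0 < a" "a < s" "a < t" "s < b" "t < b"
  shows "(u1 b * (D2 b - 1) - u2 b * (D1 b - 1)) - (u1 a * D2 a - u2 a * D1 a)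
    = u2 s - u1 t + integral {a..b} (\<lambda>x. (q2 x - q1 x) * u1 x * u2 x)"
proof -
  have prim_u: "primitive_on a b (\<lambda>x. D x + - (if x > s then 1 else 0)) u"
    if "primitive_on a b f D"
      and d: "\<And>x. x > 0 \<Longrightarrow> ((\<lambda>x. u x + of_real (max 0 (x - s))) has_vector_derivative D x) (at x)"
    for f D u s
  proof -
    have "continuous_on {a..b} (\<lambda>x. u x + of_real (max 0 (x - s)))"
      using ab by (intro continuous_at_imp_continuous_on ballI has_vector_derivative_continuous[OF d]) auto
    then have P: "primitive_on a b D (\<lambda>x. u x + of_real (max 0 (x - s)))"
      using ab bounded_measurable_on_continuous[OF primitive_on_continuous_on[OF that(1)]]
      by (intro primitive_on_if_derivative[where S="{}"]) (auto intro!: d)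
    have Q: "primitive_on a b (\<lambda>x. - (if x > s then 1 else 0)) (\<lambda>x. - complex_of_real (max 0 (x - s)))"
    proof -
      have "primitive_on a b (\<lambda>x. 0) (\<lambda>x. -1)"
        by (rule primitive_on_if_derivative[where S="{}"]) (auto intro!: bounded_measurable_on_continuous)
      from primitive_on_mult[OF this primitive_on_ramp[of a b s]] show ?thesis by simp
    qed
    show ?thesis
      using primitive_on_add[OF P Q] by simp
  qed
  \<comment> \<open>A step times \<open>D\<close> integrates to the increment over [s, b] of the
    function whose derivative is \<open>D\<close>, that is of \<open>u\<close> plus its own ramp at
    \<open>s'\<close>.\<close>
  have jump: "integral {a..b} (\<lambda>x. (if x > s then 1 else 0) * D x) = u b + of_real (b - s') - (u s + of_real (max 0 (s - s')))"
    "(\<lambda>x. (if x > s then 1 else 0) * D x) integrable_on {a..b}"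
    if D: "primitive_on a b f D" and s: "a < s" "s < b" "s' < b"
      and d: "\<And>x. x > 0 \<Longrightarrow> ((\<lambda>x. u x + of_real (max 0 (x - s'))) has_vector_derivative D x) (at x)"
    for f D u s s'
  proof -
    show int: "(\<lambda>x. (if x > s then 1 else 0) * D x) integrable_on {a..b}"
      by (intro bounded_measurable_on_integrable bounded_measurable_on_mult bounded_measurable_on_step
          bounded_measurable_on_continuous primitive_on_continuous_on[OF D])
    have "integral {a..b} (\<lambda>x. (if x > s then 1 else 0) * D x)
        = integral {a..s} (\<lambda>x. (if x > s then 1 else 0) * D x) + integral {s..b} (\<lambda>x. (if x > s then 1 else 0) * D x)"
      using s int by (intro Henstock_Kurzweil_Integration.integral_combine[symmetric]) auto
    also have "integral {a..s} (\<lambda>x. (if x > s then 1 else 0) * D x) = integral {a..s} (\<lambda>x. 0)"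
      by (rule Henstock_Kurzweil_Integration.integral_cong) auto
    also have "integral {s..b} (\<lambda>x. (if x > s then 1 else 0) * D x) = integral {s..b} D"
      by (rule integral_spike[of "{s}"]) auto
    also have "integral {s..b} D = u b + of_real (max 0 (b - s')) - (u s + of_real (max 0 (s - s')))"
      using s ab(1) d
      by (intro integral_unique fundamental_theorem_of_calculus) (auto intro: has_vector_derivative_at_within)
    finally show "integral {a..b} (\<lambda>x. (if x > s then 1 else 0) * D x) = u b + of_real (b - s') - (u s + of_real (max 0 (s - s')))"
      using s by simp
  qed
  \<comment> \<open>The Wronskian is handled as two separate products. In the difference of their
    densities D1 D2 cancels, leaving the volume term and two step terms that carry the point
    sources.\<close>
  define F1 where "F1 x = (D1 x + - (if x > s then 1 else 0)) * D2 x + u1 x * (q2 x * u2 x)" for x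
  define F2 where "F2 x = (D2 x + - (if x > t then 1 else 0)) * D1 x + u2 x * (q1 x * u1 x)" for x
  have P1: "primitive_on a b F1 (\<lambda>x. u1 x * D2 x)"
    unfolding F1_def by (rule primitive_on_mult[OF prim_u[OF p1 d1] p2])
  have P2: "primitive_on a b F2 (\<lambda>x. u2 x * D1 x)"
    unfolding F2_def by (rule primitive_on_mult[OF prim_u[OF p2 d2] p1])
  note J1 = jump[OF p2 _ _ _ d2, of s] and J2 = jump[OF p1 _ _ _ d1, of t]
  define K where "K x = (q2 x - q1 x) * u1 x * u2 x" for x
  have F12: "F1 integrable_on {a..b}" "F2 integrable_on {a..b}"
    using P1 P2 by (auto intro!: bounded_measurable_on_integrable primitive_on_bounded_measurable)
  have K: "K = (\<lambda>x. (F1 x - F2 x) + ((if x > s then 1 else 0) * D2 x - (if x > t then 1 else 0) * D1 x))"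
    by (rule ext) (simp add: K_def F1_def F2_def algebra_simps)
  have "integral {a..b} K = integral {a..b} F1 - integral {a..b} F2
      + (integral {a..b} (\<lambda>x. (if x > s then 1 else 0) * D2 x) - integral {a..b} (\<lambda>x. (if x > t then 1 else 0) * D1 x))"
    unfolding K using ab
    by (intro integral_unique has_integral_add has_integral_diff integrable_integral F12 J1(2) J2(2)) auto
  moreover have "u1 b * D2 b = u1 a * D2 a + integral {a..b} F1" "u2 b * D1 b = u2 a * D1 a + integral {a..b} F2"
    using primitive_onD[OF P1, of b] primitive_onD[OF P2, of b] ab by auto
  \<comment> \<open>The ramp contributions of the two jump integrals cancel: (b - t) - (b - s) = s -
    t is exactly this difference.\<close>
  moreover have "complex_of_real (max 0 (s - t)) - of_real (max 0 (t - s)) = of_real (s - t)"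
    by (simp add: max_def)
  moreover note J1(1) J2(1)
  ultimately show ?thesis
    using ab unfolding K_def[symmetric] of_real_diff by (simp, algebra)
qed

section \<open>Complex conjugation of weak solutions\<close>

lemma foldr_pdiff_cnj:
  fixes \<phi> :: "real \<Rightarrow> complex"
  assumes "smooth_fun \<phi>" "set bs \<subseteq> Basis"
  shows "foldr pdiff bs (\<lambda>x. cnj (\<phi> x)) = (\<lambda>x. cnj (foldr pdiff bs \<phi> x))"
  using assms(2)
proof (induction bs)
  case (Cons b bs)
  then have b: "b = 1" and bs: "set bs \<subseteq> Basis" by auto
  have "foldr pdiff bs \<phi> differentiable (at x)" for x
    using assms(1) bs unfolding smooth_fun_def by blast
  then have d: "(foldr pdiff bs \<phi> has_vector_derivative pdiff 1 (foldr pdiff bs \<phi>) x) (at x)" for x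
    by (rule differentiable_has_pdiff)
  have "pdiff 1 (\<lambda>x. cnj (foldr pdiff bs \<phi> x)) x = cnj (pdiff 1 (foldr pdiff bs \<phi>) x)" for x
    by (intro pdiff_eqI has_vector_derivative_cnj d)
  then show ?case by (auto simp: Cons.IH[OF bs] b)
qed simp

lemma test_functions_cnj:
  fixes \<phi> :: "real \<Rightarrow> complex"
  assumes "\<phi> \<in> test_functions U"
  shows "(\<lambda>x. cnj (\<phi> x)) \<in> test_functions U"
    and "laplacian (\<lambda>x. cnj (\<phi> x)) x = cnj (laplacian \<phi> x)"
proof -
  have sm: "smooth_fun \<phi>" using assms by (simp add: test_functions_def)
  have "(\<lambda>x. cnj (g x)) differentiable (at x)" if "g differentiable (at x)" for g :: "real \<Rightarrow> complex" and x
    using has_vector_derivative_cnj[OF differentiable_has_pdiff[OF that]] by (rule differentiableI_vector)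
  then have "smooth_fun (\<lambda>x. cnj (\<phi> x))"
    using sm foldr_pdiff_cnj[OF sm] by (simp add: smooth_fun_def)
  then show "(\<lambda>x. cnj (\<phi> x)) \<in> test_functions U"
    using assms by (auto simp: test_functions_def)
  show "laplacian (\<lambda>x. cnj (\<phi> x)) x = cnj (laplacian \<phi> x)"
    using foldr_pdiff_cnj[OF sm, of "[1, 1]"] by (simp add: laplacian_real fun_eq_iff)
qed

text \<open>The pairing is bilinear, so the given equation is tested with the conjugate of
  \<open>\<phi>\<close> and the result is conjugated.\<close>

lemma weak_green_cnj:
  assumes "weak_green q s u"
  shows "weak_green (\<lambda>x. cnj (q x)) s (\<lambda>x. cnj (u x))"
  unfolding weak_green_def
proof (intro conjI ballI)
  show "continuous_on {0<..} (\<lambda>x. cnj (u x))"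
    using assms by (auto simp: weak_green_def intro: continuous_intros)
  fix \<phi> :: "real \<Rightarrow> complex" assume \<phi>: "\<phi> \<in> test_functions {0<..}"
  have "(LINT r|lebesgue_on {0<..}. u r * (- cnj (laplacian \<phi> r) + q r * cnj (\<phi> r))) = cnj (\<phi> s)"
    using assms[unfolded weak_green_def, THEN conjunct2, rule_format, OF test_functions_cnj(1)[OF \<phi>]]
    unfolding test_functions_cnj(2)[OF \<phi>] .
  then have "cnj (LINT r|lebesgue_on {0<..}. u r * (- cnj (laplacian \<phi> r) + q r * cnj (\<phi> r))) = \<phi> s"
    by simp
  then show "(LINT r|lebesgue_on {0<..}. cnj (u r) * (- laplacian \<phi> r + cnj (q r) * \<phi> r)) = \<phi> s"
    by (simp add: Bochner_Integration.integral_cnj[symmetric] del: Bochner_Integration.integral_cnj)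
qed

section \<open>Interpolation and the behaviour near the origin\<close>

text \<open>The mean value inequality for d(x) - x D(y): if the derivative hardly varies over the
  interval, a large value of it would force a large increment of \<open>d\<close>.\<close>

lemma derivative_bound_from_increments:
  fixes d D :: "real \<Rightarrow> complex"
  assumes "h > 0" and d: "\<And>x. x \<in> {y..y+h} \<Longrightarrow> (d has_vector_derivative D x) (at x)"
    and D: "\<And>x. x \<in> {y..y+h} \<Longrightarrow> norm (D x - D y) \<le> K"
  shows "h * norm (D y) \<le> norm (d (y + h)) + norm (d y) + K * h"
proof -
  define f where "f x = d x - of_real x * D y" for x
  have "norm (f (y + h) - f y) \<le> K * norm (y + h - y)"
  proof (rule differentiable_bound[where S="{y..y+h}"])
    fix x assume x: "x \<in> {y..y+h}"
    have "(f has_vector_derivative D x - of_real 1 * D y) (at x)"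
      unfolding f_def
      by (intro derivative_intros d x has_vector_derivative_of_real[unfolded o_def])
    then show "(f has_derivative (\<lambda>h. h *\<^sub>R (D x - D y))) (at x within {y..y+h})"
      by (auto simp: has_vector_derivative_def intro: has_derivative_at_withinI)
    show "onorm (\<lambda>h. h *\<^sub>R (D x - D y)) \<le> K"
      using mult_right_mono[OF D[OF x] abs_ge_zero] by (intro onorm_le) (simp add: mult.commute)
  qed (use assms(1) in auto)
  then have *: "norm (d (y + h) - d y - of_real h * D y) \<le> K * h"
    using assms(1) by (simp add: f_def algebra_simps)
  have "of_real h * D y = d (y + h) - d y - (d (y + h) - d y - of_real h * D y)" by simp
  then have "norm (of_real h * D y) \<le> norm (d (y + h)) + norm (d y) + norm (d (y + h) - d y - of_real h * D y)"
    by (metis norm_triangle_ineq4 norm_triangle_le_diff order_trans add_right_mono)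
  with * assms(1) show ?thesis by (simp add: norm_mult)
qed

text \<open>Interpolation on [y, 2y]. There |q u| is at most Q M / y, so \<open>D\<close> varies by
  at most Q M, while the values of \<open>u\<close> at the two ends contribute 2 M y + M y; division
  by the length y gives the constant. The ramp vanishes on this range.\<close>

lemma derivative_bounded_near_0:
  assumes p: "\<And>a b. 0 < a \<Longrightarrow> primitive_on a b (\<lambda>x. q x * u x) D"
    and d: "\<And>x. x > 0 \<Longrightarrow> ((\<lambda>x. u x + of_real (max 0 (x - s))) has_vector_derivative D x) (at x)"
    and \<delta>: "\<delta> > 0" "\<delta> \<le> s"
    and u: "\<And>x. 0 < x \<Longrightarrow> x \<le> \<delta> \<Longrightarrow> norm (u x) \<le> M * x"
    and q: "\<And>x. 0 < x \<Longrightarrow> x \<le> \<delta> \<Longrightarrow> norm (q x) \<le> Q / x\<^sup>2"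
    and y: "0 < y" "2 * y \<le> \<delta>"
  shows "norm (D y) \<le> 3 * M + Q * M"
proof -
  have "norm (u y) \<ge> 0" by simp
  with u[of y] y \<delta> have "M * y \<ge> 0" by (smt (verit))
  with y have M: "M \<ge> 0" by (simp add: zero_le_mult_iff)
  have "norm (q y) \<ge> 0" by simp
  with q[of y] y \<delta> have "Q / y\<^sup>2 \<ge> 0" by (smt (verit))
  with y have Q: "Q \<ge> 0" by (simp add: zero_le_divide_iff)
  define v where "v x = u x + of_real (max 0 (x - s))" for x
  have v: "v x = u x" if "x \<le> \<delta>" for x using that \<delta> by (simp add: v_def)
  have "norm (q x * u x) \<le> Q * M / y" if x: "x \<in> {y..y+y}" for x
  proof -
    have "norm (q x * u x) \<le> Q / x\<^sup>2 * (M * x)"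
      unfolding norm_mult using x y Q by (intro mult_mono q u) auto
    also have "\<dots> = Q * M / x" using x y by (simp add: power2_eq_square)
    also have "\<dots> \<le> Q * M / y" using x y M Q by (intro divide_left_mono) auto
    finally show ?thesis .
  qed
  then have "norm (D x - D y) \<le> Q * M" if "x \<in> {y..y+y}" for x
  proof -
    have "norm (D x - D y) \<le> Q * M / y * \<bar>x - y\<bar>"
      using \<open>\<And>x. x \<in> {y..y+y} \<Longrightarrow> norm (q x * u x) \<le> Q * M / y\<close> that y
      by (intro primitive_on_lipschitz[OF p[of y "y+y"]]) auto
    also have "\<dots> \<le> Q * M / y * y"
      using that y M Q by (intro mult_left_mono) auto
    finally show ?thesis using y by simp
  qed
  then have "y * norm (D y) \<le> norm (v (y + y)) + norm (v y) + Q * M * y"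
    using y d unfolding v_def[abs_def] by (intro derivative_bound_from_increments) auto
  also have "\<dots> \<le> M * (y + y) + M * y + Q * M * y"
    using v y \<delta> by (intro add_mono) (auto intro!: u)
  finally have "y * norm (D y) \<le> y * (3 * M + Q * M)" by (simp add: algebra_simps)
  then show ?thesis using y by simp
qed

section \<open>Outgoing solutions\<close>

text \<open>Trades the Landau symbol for explicit constants; with \<open>N \<ge> 1\<close> a term in
  1/r^2 can be absorbed into 1/r.\<close>

lemma bigo_inverse_at_top_iff:
  fixes f :: "real \<Rightarrow> complex"
  shows "f \<in> O[at_top](\<lambda>r. complex_of_real (1 / r)) \<longleftrightarrow>
    (\<exists>K\<ge>0. \<exists>N\<ge>1. \<forall>r\<ge>N. norm (f r) \<le> K / r)"
proof
  assume "f \<in> O[at_top](\<lambda>r. complex_of_real (1 / r))"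
  then obtain K where K: "K > 0" "\<forall>\<^sub>F r in at_top. norm (f r) \<le> K * norm (complex_of_real (1 / r))"
    by (auto elim: landau_o.bigE)
  then obtain N where N: "\<And>r. r \<ge> N \<Longrightarrow> norm (f r) \<le> K * norm (complex_of_real (1 / r))"
    by (auto simp: eventually_at_top_linorder)
  have "norm (f r) \<le> K / r" if "r \<ge> max N 1" for r
    using N[of r] that by (simp add: norm_divide)
  then show "\<exists>K\<ge>0. \<exists>N\<ge>1. \<forall>r\<ge>N. norm (f r) \<le> K / r"
    using K(1) by (intro exI[of _ K] exI[of _ "max N 1"] conjI) auto
next
  assume "\<exists>K\<ge>0. \<exists>N\<ge>1. \<forall>r\<ge>N. norm (f r) \<le> K / r"
  then obtain K N where KN: "N \<ge> 1" "\<forall>r\<ge>N. norm (f r) \<le> K / r" by blast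
  then have "norm (f r) \<le> K * norm (complex_of_real (1 / r))" if "r \<ge> N" for r
    using that by (simp add: norm_divide)
  then show "f \<in> O[at_top](\<lambda>r. complex_of_real (1 / r))"
    by (intro bigoI[of _ K]) (auto simp: eventually_at_top_linorder)
qed

text \<open>The leading term of the outgoing Coulomb function. It is explicit and unimodular, hence
  easier to differentiate and to multiply than the function itself.\<close>

definition coulomb_wave :: "real \<Rightarrow> real \<Rightarrow> nat \<Rightarrow> real \<Rightarrow> complex" where
  "coulomb_wave \<alpha> k l r = exp (\<i> * of_real (coulomb_phase l (\<alpha> / (2 * k)) (k * r)))"

lemma norm_coulomb_wave [simp]: "norm (coulomb_wave \<alpha> k l r) = 1"
  by (simp add: coulomb_wave_def)

lemma coulomb_wave_has_vector_derivative:
  assumes "k > 0" "r > 0"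
  shows "(coulomb_wave \<alpha> k l has_vector_derivative
    \<i> * of_real (k - \<alpha> / (2 * k) / r) * coulomb_wave \<alpha> k l r) (at r)"
proof -
  define \<theta> where "\<theta> r = coulomb_phase l (\<alpha> / (2 * k)) (k * r)" for r
  have "(\<theta> has_real_derivative k - \<alpha> / (2 * k) / r) (at r)"
    unfolding \<theta>_def coulomb_phase_def using assms
    by (auto intro!: derivative_eq_intros simp: field_simps)
  then have "((\<lambda>r. complex_of_real (\<theta> r)) has_vector_derivative of_real (k - \<alpha> / (2 * k) / r)) (at r)"
    by (rule has_vector_derivative_of_real[unfolded o_def])
  moreover have "((\<lambda>z. exp (\<i> * z)) has_field_derivative \<i> * exp (\<i> * of_real (\<theta> r))) (at (complex_of_real (\<theta> r)))"
    by (auto intro!: derivative_eq_intros)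
  ultimately have "((\<lambda>z. exp (\<i> * z)) \<circ> (\<lambda>r. complex_of_real (\<theta> r)) has_vector_derivative
      of_real (k - \<alpha> / (2 * k) / r) * (\<i> * exp (\<i> * of_real (\<theta> r)))) (at r)"
    by (rule field_vector_diff_chain_at)
  then show ?thesis
    by (simp add: o_def coulomb_wave_def[abs_def] \<theta>_def mult_ac)
qed

text \<open>
  The definition of \<open>H\<^sup>+\<close> controls only \<open>h\<close>. The error \<open>d = h - e\<close> satisfies \<open>d'' = O(1/r)\<close> by the
  Coulomb equation (the \<open>\<alpha>/r\<close> term is cancelled by the logarithmic phase), and interpolating between
  \<open>d\<close> and \<open>d''\<close> on \<open>[r, r + 1]\<close> gives \<open>d' = O(1/r)\<close>.
\<close>

lemma coulomb_Hplus_derivative_asymp: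
  assumes h: "is_coulomb_Hplus \<alpha> k l h" and k: "k > 0"
  obtains h' where "\<And>r. r > 0 \<Longrightarrow> (h has_vector_derivative h' r) (at r)"
    "(\<lambda>r. h r - coulomb_wave \<alpha> k l r) \<in> O[at_top](\<lambda>r. complex_of_real (1 / r))"
    "(\<lambda>r. h' r - \<i> * of_real k * coulomb_wave \<alpha> k l r) \<in> O[at_top](\<lambda>r. complex_of_real (1 / r))"
proof -
  define e where "e = coulomb_wave \<alpha> k l"
  define \<eta> where "\<eta> = \<alpha> / (2 * k)"
  define L where "L = real (l * (l + 1))"
  obtain h' h'' where ode: "\<And>r. r > 0 \<Longrightarrow>
      (h has_vector_derivative h' r) (at r) \<and> (h' has_vector_derivative h'' r) (at r) \<and>
      - h'' r + of_real (L / r\<^sup>2) * h r + of_real (\<alpha> / r) * h r - of_real (k\<^sup>2) * h r = 0"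
    and asym: "(\<lambda>r. h r - e r) \<in> O[at_top](\<lambda>r. complex_of_real (1 / r))"
    using h unfolding is_coulomb_Hplus_def e_def coulomb_wave_def L_def by blast
  obtain K N where KN: "K \<ge> 0" "N \<ge> 1" "\<And>r. r \<ge> N \<Longrightarrow> norm (h r - e r) \<le> K / r"
    using asym unfolding bigo_inverse_at_top_iff by blast
  define d where "d r = h r - e r" for r
  define D where "D r = h' r - \<i> * of_real (k - \<eta> / r) * e r" for r
  \<comment> \<open>The second derivative of \<open>d\<close>, with \<open>h''\<close> taken from
    the Coulomb equation and h written as d + e. With \<alpha> = 2 k \<eta> the square of k -
    \<eta>/r cancels both -k^2 and \<alpha>/r, so only terms in 1/r^2 multiply
    \<open>e\<close>.\<close>
  define D' where "D' r = of_real (L / r\<^sup>2 + \<alpha> / r - k\<^sup>2) * d r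
     + (of_real (L / r\<^sup>2) - \<i> * of_real (\<eta> / r\<^sup>2) + of_real (\<eta>\<^sup>2 / r\<^sup>2)) * e r" for r
  have de: "(e has_vector_derivative \<i> * of_real (k - \<eta> / r) * e r) (at r)" if "r > 0" for r
    unfolding e_def \<eta>_def using coulomb_wave_has_vector_derivative[OF k that] .
  have dd: "(d has_vector_derivative D r) (at r)" if "r > 0" for r
    unfolding d_def D_def using ode that by (intro derivative_intros de) auto
  have dD: "(D has_vector_derivative D' r) (at r)" if r: "r > 0" for r
  proof -
    have "((\<lambda>r. complex_of_real (k - \<eta> / r)) has_vector_derivative of_real (\<eta> / r\<^sup>2)) (at r)"
      using r by (intro has_vector_derivative_of_real[unfolded o_def])
        (auto intro!: derivative_eq_intros simp: power2_eq_square)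
    then have "(D has_vector_derivative h'' r - (\<i> * of_real (k - \<eta> / r) * (\<i> * of_real (k - \<eta> / r) * e r)
       + (\<i> * of_real (\<eta> / r\<^sup>2)) * e r)) (at r)"
      unfolding D_def using ode[OF r]
      by (intro has_vector_derivative_diff has_vector_derivative_mult has_vector_derivative_mult_right de r) auto
    moreover have "h'' r = of_real (L / r\<^sup>2 + \<alpha> / r - k\<^sup>2) * (d r + e r)"
      using ode[OF r] by (simp add: d_def algebra_simps)
    moreover have "\<alpha> = 2 * k * \<eta>" using k by (simp add: \<eta>_def)
    then have "of_real (L / r\<^sup>2 + \<alpha> / r - k\<^sup>2) + complex_of_real (k - \<eta> / r) * complex_of_real (k - \<eta> / r)
        = of_real (L / r\<^sup>2) + of_real (\<eta>\<^sup>2 / r\<^sup>2)"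
      unfolding of_real_mult[symmetric] of_real_add[symmetric] of_real_eq_iff using r
      by (simp add: field_simps power2_eq_square)
    then have "of_real (L / r\<^sup>2 + \<alpha> / r - k\<^sup>2) * (d r + e r) - (\<i> * of_real (k - \<eta> / r) * (\<i> * of_real (k - \<eta> / r) * e r)
       + (\<i> * of_real (\<eta> / r\<^sup>2)) * e r) = D' r"
      unfolding D'_def using i_squared by algebra
    ultimately show ?thesis by metis
  qed
  \<comment> \<open>The first summand bounds the coefficient of \<open>d\<close> for r at least 1,
    times the constant of d = O(1/r); the second collects the coefficients of
    \<open>e\<close>.\<close>
  define C where "C = (L + \<bar>\<alpha>\<bar> + k\<^sup>2) * K + (L + \<bar>\<eta>\<bar> + \<eta>\<^sup>2)"
  have L: "L \<ge> 0" by (simp add: L_def)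
  have D'_bound: "norm (D' r) \<le> C / r" if "r \<ge> N" for r
  proof -
    have r: "r \<ge> 1" using that KN by simp
    have inv: "c / r\<^sup>2 \<le> c / r" "c / r \<le> c" if "c \<ge> 0" for c
      using r that mult_left_mono[OF r that] by (auto simp: power2_eq_square field_simps)
    have inv2: "c / r\<^sup>2 \<le> c" if "c \<ge> 0" for c
      using inv[OF that] by simp
    have "\<bar>L / r\<^sup>2 + \<alpha> / r - k\<^sup>2\<bar> \<le> L / r\<^sup>2 + \<bar>\<alpha>\<bar> / r + k\<^sup>2"
      using L r by (intro order_trans[OF abs_triangle_ineq4] add_mono order_trans[OF abs_triangle_ineq]) auto
    also have "\<dots> \<le> L + \<bar>\<alpha>\<bar> + k\<^sup>2"
      using L by (intro add_mono inv2 inv) auto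
    finally have "norm (of_real (L / r\<^sup>2 + \<alpha> / r - k\<^sup>2) * d r) \<le> (L + \<bar>\<alpha>\<bar> + k\<^sup>2) * (K / r)"
      unfolding norm_mult norm_of_real d_def using KN that L
      by (intro mult_mono) auto
    moreover have "norm (complex_of_real (L / r\<^sup>2) - \<i> * of_real (\<eta> / r\<^sup>2) + of_real (\<eta>\<^sup>2 / r\<^sup>2))
       \<le> L / r\<^sup>2 + \<bar>\<eta>\<bar> / r\<^sup>2 + \<eta>\<^sup>2 / r\<^sup>2"
      using L by (intro order_trans[OF norm_triangle_ineq] add_mono order_trans[OF norm_triangle_ineq4])
        (auto simp: norm_mult norm_divide norm_power)
    moreover have "\<dots> \<le> (L + \<bar>\<eta>\<bar> + \<eta>\<^sup>2) / r"
      unfolding add_divide_distrib using L by (intro add_mono inv) auto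
    ultimately have "norm (of_real (L / r\<^sup>2 + \<alpha> / r - k\<^sup>2) * d r)
       + norm ((complex_of_real (L / r\<^sup>2) - \<i> * of_real (\<eta> / r\<^sup>2) + of_real (\<eta>\<^sup>2 / r\<^sup>2)) * e r)
       \<le> (L + \<bar>\<alpha>\<bar> + k\<^sup>2) * (K / r) + (L + \<bar>\<eta>\<bar> + \<eta>\<^sup>2) / r"
      unfolding norm_mult[of _ "e r"] by (simp add: e_def)
    also have "\<dots> = C / r" by (simp add: C_def add_divide_distrib)
    finally show ?thesis unfolding D'_def by (rule norm_triangle_le)
  qed
  have C: "C \<ge> 0" unfolding C_def using L KN by auto
  \<comment> \<open>On [r, r + 1] the two end values of \<open>d\<close> give 2 K / r and the
    oscillation of \<open>D\<close> gives C / r.\<close>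
  have D_bound: "norm (D r) \<le> (2 * K + C) / r" if "r \<ge> N" for r
  proof -
    have r: "r \<ge> 1" using that KN by simp
    have incr: "norm (D x - D r) \<le> C / r" if x: "x \<in> {r..r+1}" for x
    proof -
      have "norm (D x - D r) \<le> C / r * norm (x - r)"
      proof (rule differentiable_bound[where S="{r..r+1}"])
        fix y assume y: "y \<in> {r..r+1}"
        show "(D has_derivative (\<lambda>h. h *\<^sub>R D' y)) (at y within {r..r+1})"
          using dD[of y] y r by (auto simp: has_vector_derivative_def intro: has_derivative_at_withinI)
        have "norm (D' y) \<le> C / y" using D'_bound[of y] y \<open>r \<ge> N\<close> by simp
        also have "\<dots> \<le> C / r" using y r C by (intro divide_left_mono) auto
        finally have D'_le: "norm (D' y) \<le> C / r" .
        show "onorm (\<lambda>h. h *\<^sub>R D' y) \<le> C / r"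
        proof (rule onorm_le)
          show "norm (h *\<^sub>R D' y) \<le> C / r * norm h" for h :: real
            using mult_right_mono[OF D'_le, of "norm h"] by (simp only: norm_scaleR real_norm_def mult.commute)
        qed
      qed (use x in auto)
      also have "\<dots> \<le> C / r * 1" using x C r by (intro mult_left_mono) auto
      finally show ?thesis by simp
    qed
    have "1 * norm (D r) \<le> norm (d (r + 1)) + norm (d r) + C / r * 1"
      using r by (intro derivative_bound_from_increments dd incr) auto
    moreover have "norm (d r) \<le> K / r" using KN(3)[OF that] by (simp add: d_def)
    moreover have "norm (d (r + 1)) \<le> K / (r + 1)" using KN(3)[of "r + 1"] that by (simp add: d_def)
    moreover have "K / (r + 1) \<le> K / r" using r KN by (intro divide_left_mono) auto
    ultimately show ?thesis by (simp add: add_divide_distrib)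
  qed
  have "norm (h' r - \<i> * of_real k * e r) \<le> (2 * K + C + \<bar>\<eta>\<bar>) / r" if "r \<ge> N" for r
  proof -
    have r: "r > 0" using that KN by simp
    have "h' r - \<i> * of_real k * e r = D r - \<i> * of_real (\<eta> / r) * e r"
      by (simp add: D_def algebra_simps)
    then have "norm (h' r - \<i> * of_real k * e r) \<le> norm (D r) + norm (\<i> * of_real (\<eta> / r) * e r)"
      by (simp only: norm_triangle_ineq4)
    also have "\<dots> \<le> (2 * K + C) / r + \<bar>\<eta>\<bar> / r"
      using D_bound[OF that] r by (intro add_mono) (simp_all add: norm_mult norm_divide e_def)
    finally show ?thesis by (simp add: add_divide_distrib)
  qed
  then have "(\<lambda>r. h' r - \<i> * of_real k * e r) \<in> O[at_top](\<lambda>r. complex_of_real (1 / r))"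
    unfolding bigo_inverse_at_top_iff using KN C
    by (intro exI[of _ "2 * K + C + \<bar>\<eta>\<bar>"] exI[of _ N]) auto
  then show ?thesis
    using ode asym by (intro that[of h']) (auto simp: e_def)
qed

lemma bigo_mult_one_left:
  assumes "f \<in> O[F](\<lambda>r. 1 :: complex)" "g \<in> O[F](h)"
  shows "(\<lambda>r. f r * g r) \<in> O[F](h)"
  using landau_o.big.mult[OF assms] by simp

lemma bigo_mult_one_right:
  assumes "f \<in> O[F](h)" "g \<in> O[F](\<lambda>r. 1 :: complex)"
  shows "(\<lambda>r. f r * g r) \<in> O[F](h)"
  using landau_o.big.mult[OF assms] by simp

lemma bigo_one_perturbation:
  assumes "(\<lambda>r. f r - c * g r) \<in> O[at_top](\<lambda>r. complex_of_real (1 / r))" "\<And>r. norm (g r) \<le> B"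
  shows "f \<in> O[at_top](\<lambda>r. 1 :: complex)"
proof -
  have "(\<lambda>r. c * g r) \<in> O[at_top](\<lambda>r. 1 :: complex)"
    by (rule bigoI[of _ "norm c * B"]) (use assms(2) in \<open>auto simp: norm_mult intro!: mult_left_mono always_eventually\<close>)
  moreover have "(\<lambda>r. complex_of_real (1 / r)) \<in> O[at_top](\<lambda>r. 1 :: complex)"
  proof (rule bigoI[of _ 1])
    show "\<forall>\<^sub>F r in at_top. norm (complex_of_real (1 / r)) \<le> 1 * norm (1::complex)"
      using eventually_ge_at_top[of 1] by eventually_elim (simp add: norm_divide)
  qed
  then have "(\<lambda>r. f r - c * g r) \<in> O[at_top](\<lambda>r. 1 :: complex)"
    using assms(1) landau_o.big_trans by blast
  ultimately have "(\<lambda>r. (f r - c * g r) + c * g r) \<in> O[at_top](\<lambda>r. 1 :: complex)"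
    by (rule sum_in_bigo(1)[rotated])
  then show ?thesis by simp
qed

text \<open>Collects what Green's identity needs at both ends for one column. Near infinity the
  derivative of \<open>u\<close> is D - 1, because the ramp has slope 1 there; near 0 it is
  \<open>D\<close>.\<close>

lemma outgoing_solution:
  assumes wg: "weak_green q s u" and s: "s > 0"
    and bq: "\<And>a b. 0 < a \<Longrightarrow> bounded_measurable_on a b q"
    and q0: "\<And>x. 0 < x \<Longrightarrow> x \<le> 1 \<Longrightarrow> norm (q x) \<le> Q / x\<^sup>2"
    and u0: "u \<in> O[at_right 0](\<lambda>r. complex_of_real (r ^ (l + 1)))"
    and k: "k > 0" and h: "is_coulomb_Hplus \<alpha> k l h" and out: "\<forall>\<^sub>F r in at_top. u r = c * h r"
  obtains D where "\<And>a b. 0 < a \<Longrightarrow> primitive_on a b (\<lambda>x. q x * u x) D"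
    "\<And>x. x > 0 \<Longrightarrow> ((\<lambda>x. u x + of_real (max 0 (x - s))) has_vector_derivative D x) (at x)"
    "(\<lambda>r. u r - c * coulomb_wave \<alpha> k l r) \<in> O[at_top](\<lambda>r. complex_of_real (1 / r))"
    "(\<lambda>r. D r - 1 - c * (\<i> * of_real k * coulomb_wave \<alpha> k l r)) \<in> O[at_top](\<lambda>r. complex_of_real (1 / r))"
    "(u \<longlongrightarrow> 0) (at_right 0)" "Bfun D (at_right 0)"
proof -
  obtain D where prim: "\<And>a b. 0 < a \<Longrightarrow> primitive_on a b (\<lambda>x. q x * u x) D"
    and deriv: "\<And>x. x > 0 \<Longrightarrow> ((\<lambda>x. u x + of_real (max 0 (x - s))) has_vector_derivative D x) (at x)"
    using weak_green_regular[OF wg s bq] by blast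
  obtain M where M: "M > 0" "\<forall>\<^sub>F r in at_right 0. norm (u r) \<le> M * norm (complex_of_real (r ^ (l + 1)))"
    using u0 by (rule landau_o.bigE)
  then obtain b where b: "b > 0" "\<And>r. 0 < r \<Longrightarrow> r < b \<Longrightarrow> norm (u r) \<le> M * norm (complex_of_real (r ^ (l + 1)))"
    unfolding eventually_at_right_field by auto
  \<comment> \<open>Below \<open>b\<close> for the bound on \<open>u\<close>, at most
    \<open>s\<close> to stay left of the kink, at most 1 so that r^(l+1) is at most r and
    \<open>q0\<close> applies.\<close>
  define \<delta> where "\<delta> = min (b / 2) (min s 1)"
  have \<delta>: "0 < \<delta>" "\<delta> \<le> s" "\<delta> \<le> 1" "\<delta> < b" using b s by (auto simp: \<delta>_def)
  have u_le: "norm (u x) \<le> M * x" if x: "0 < x" "x \<le> \<delta>" for x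
  proof -
    have "norm (u x) \<le> M * x ^ (l + 1)" using b(2)[of x] x \<delta> by (simp add: norm_power norm_mult)
    also have "x ^ (l + 1) \<le> x ^ 1" using x \<delta> by (intro power_decreasing) auto
    finally show ?thesis using M(1) by (simp add: mult_left_mono)
  qed
  have ev: "\<forall>\<^sub>F x in at_right 0. 0 < x \<and> x \<le> \<delta> / 2"
    unfolding eventually_at_right_field using \<delta> by (intro exI[of _ "\<delta> / 2"]) auto
  have u_lim: "(u \<longlongrightarrow> 0) (at_right 0)"
  proof (rule Lim_null_comparison)
    show "\<forall>\<^sub>F x in at_right 0. norm (u x) \<le> M * x"
      using ev by eventually_elim (use \<delta> in \<open>auto intro: u_le\<close>)
    show "((\<lambda>x. M * x) \<longlongrightarrow> 0) (at_right 0)" by (auto intro!: tendsto_eq_intros)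
  qed
  have D_bdd: "Bfun D (at_right 0)"
  proof (rule BfunI)
    show "\<forall>\<^sub>F x in at_right 0. norm (D x) \<le> 3 * M + Q * M"
      using ev
    proof eventually_elim
      case (elim x)
      show ?case
        by (rule derivative_bounded_near_0[OF prim deriv \<delta>(1,2) u_le q0]) (use elim \<delta> in auto)
    qed
  qed
  obtain h' where h': "\<And>r. r > 0 \<Longrightarrow> (h has_vector_derivative h' r) (at r)"
    "(\<lambda>r. h r - coulomb_wave \<alpha> k l r) \<in> O[at_top](\<lambda>r. complex_of_real (1 / r))"
    "(\<lambda>r. h' r - \<i> * of_real k * coulomb_wave \<alpha> k l r) \<in> O[at_top](\<lambda>r. complex_of_real (1 / r))"
    using coulomb_Hplus_derivative_asymp[OF h k] by blast
  obtain N where N: "\<And>r. r \<ge> N \<Longrightarrow> u r = c * h r"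
    using out unfolding eventually_at_top_linorder by blast
  define N' where "N' = max N s"
  have D_eq: "D r = c * h' r + 1" if r: "r > N'" for r
  proof -
    have rp: "r > 0" using r s by (simp add: N'_def)
    have "((\<lambda>x. c * h x + of_real (x - s)) has_vector_derivative c * h' r + of_real 1) (at r)"
      by (intro derivative_intros h' rp has_vector_derivative_of_real[unfolded o_def])
        (auto intro!: derivative_eq_intros)
    then have "((\<lambda>x. u x + of_real (max 0 (x - s))) has_vector_derivative c * h' r + of_real 1) (at r)"
      by (rule has_vector_derivative_transform_within_open[where S="{N'<..}"])
        (use r N in \<open>auto simp: N'_def\<close>)
    with deriv[OF rp] show ?thesis using vector_derivative_unique_at by fastforce
  qed
  have "\<forall>\<^sub>F r in at_top. u r - c * coulomb_wave \<alpha> k l r = c * (h r - coulomb_wave \<alpha> k l r)"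
    using eventually_ge_at_top[of N] by eventually_elim (simp add: N algebra_simps)
  then have asym_u: "(\<lambda>r. u r - c * coulomb_wave \<alpha> k l r) \<in> O[at_top](\<lambda>r. complex_of_real (1 / r))"
    by (rule landau_o.big.in_cong[THEN iffD2]) (intro bigo_mult_one_left h'(2), simp)
  have "\<forall>\<^sub>F r in at_top. D r - 1 - c * (\<i> * of_real k * coulomb_wave \<alpha> k l r)
      = c * (h' r - \<i> * of_real k * coulomb_wave \<alpha> k l r)"
    using eventually_gt_at_top[of N'] by eventually_elim (simp add: D_eq algebra_simps)
  then have asym_D: "(\<lambda>r. D r - 1 - c * (\<i> * of_real k * coulomb_wave \<alpha> k l r)) \<in> O[at_top](\<lambda>r. complex_of_real (1 / r))"
    by (rule landau_o.big.in_cong[THEN iffD2]) (intro bigo_mult_one_left h'(3), simp)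
  show ?thesis by (rule that[OF prim deriv asym_u asym_D u_lim D_bdd])
qed

text \<open>The error telescopes as (f - c w) g + c w (g - c' w'), an O(1/r) factor times a bounded
  one in each term.\<close>

lemma bigo_product_perturbation:
  assumes f: "(\<lambda>r. f r - c * w r) \<in> O[at_top](\<lambda>r. complex_of_real (1 / r))" and w: "\<And>r. norm (w r) \<le> B"
    and g: "(\<lambda>r. g r - c' * w' r) \<in> O[at_top](\<lambda>r. complex_of_real (1 / r))" and w': "\<And>r. norm (w' r) \<le> B"
  shows "(\<lambda>r. f r * g r - c * c' * (w r * w' r)) \<in> O[at_top](\<lambda>r. complex_of_real (1 / r))"
proof -
  have "(\<lambda>r. c * w r) \<in> O[at_top](\<lambda>r. 1 :: complex)"
    by (rule bigoI[of _ "norm c * B"]) (use w in \<open>auto simp: norm_mult intro!: mult_left_mono always_eventually\<close>)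
  then have "(\<lambda>r. (f r - c * w r) * g r + c * w r * (g r - c' * w' r)) \<in> O[at_top](\<lambda>r. complex_of_real (1 / r))"
    by (intro sum_in_bigo(1) bigo_mult_one_right[OF f bigo_one_perturbation[OF g w']] bigo_mult_one_left[OF _ g])
  then show ?thesis by (simp add: algebra_simps)
qed

lemma bigo_cnj:
  assumes "f \<in> O[F](h)"
  shows "(\<lambda>r. cnj (f r)) \<in> O[F](h)"
  using assms by (subst landau_o.big.norm_iff[symmetric]) simp

lemma wronskian_tendsto_0:
  fixes u1 u2 D1 D2 :: "real \<Rightarrow> complex"
  assumes "(u1 \<longlongrightarrow> 0) F" "(u2 \<longlongrightarrow> 0) F" "Bfun D1 F" "Bfun D2 F"
  shows "((\<lambda>a. u1 a * D2 a - u2 a * D1 a) \<longlongrightarrow> 0) F"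
proof -
  have "Zfun (\<lambda>a. u1 a * D2 a) F" "Zfun (\<lambda>a. u2 a * D1 a) F"
    using assms by (auto intro!: bounded_bilinear.Zfun_prod_Bfun[OF bounded_bilinear_mult] simp: tendsto_Zfun_iff)
  from Zfun_diff[OF this] show ?thesis by (simp add: tendsto_Zfun_iff)
qed

text \<open>The limit controls a neighbourhood of 0 and compactness the rest. It serves both the
  admissibility of Green functions as test functions and the integrability of the volume
  term.\<close>

lemma bounded_image_pos_interval:
  fixes u :: "real \<Rightarrow> complex"
  assumes "continuous_on {0<..} u" "(u \<longlongrightarrow> 0) (at_right 0)"
  shows "bounded (u ` {0<..b})"
proof -
  have "\<forall>\<^sub>F x in at_right 0. norm (u x) < 1"
    using tendsto_norm_zero[OF assms(2)] by (rule order_tendstoD) simp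
  then obtain d where d: "d > 0" "\<And>x. 0 < x \<Longrightarrow> x < d \<Longrightarrow> norm (u x) < 1"
    unfolding eventually_at_right_field by auto
  have "compact (u ` {d/2..b})"
    using d(1) assms(1) by (intro compact_continuous_image) (auto elim: continuous_on_subset)
  then have "bounded (u ` {d/2..b})" by (rule compact_imp_bounded)
  then obtain K where K: "\<And>x. x \<in> {d/2..b} \<Longrightarrow> norm (u x) \<le> K"
    unfolding bounded_iff by blast
  have "norm (u x) \<le> max 1 K" if "x \<in> {0<..b}" for x
    using d(2)[of x] K[of x] that d(1) by (cases "x < d") (auto simp: less_eq_real_def)
  then show ?thesis unfolding bounded_iff by blast
qed

lemma primitive_on_cnj:
  assumes "primitive_on a b f U"
  shows "primitive_on a b (\<lambda>x. cnj (f x)) (\<lambda>x. cnj (U x))"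
  unfolding primitive_on_def
proof (intro conjI ballI)
  show "bounded_measurable_on a b (\<lambda>x. cnj (f x))"
    by (intro bounded_measurable_on_cnj primitive_on_bounded_measurable[OF assms])
  fix x assume x: "x \<in> {a..b}"
  then have "f integrable_on {a..x}"
    using bounded_measurable_on_subinterval[OF primitive_on_bounded_measurable[OF assms], of a x]
    by (auto intro: bounded_measurable_on_integrable)
  then have "((\<lambda>x. cnj (f x)) has_integral cnj (integral {a..x} f)) {a..x}"
    by (intro has_integral_linear[OF integrable_integral bounded_linear_cnj, unfolded o_def])
  then have "integral {a..x} (\<lambda>x. cnj (f x)) = cnj (integral {a..x} f)" by (rule integral_unique)
  then show "cnj (U x) = cnj (U a) + integral {a..x} (\<lambda>x. cnj (f x))"
    using primitive_onD[OF assms x] by simp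
qed

lemma bounded_measurable_on_pos:
  assumes "V \<in> borel_measurable (lebesgue_on {0<..})" "\<And>r. r > 0 \<Longrightarrow> norm (V r) \<le> C" "0 < a"
  shows "bounded_measurable_on a b V"
proof -
  have "V \<in> borel_measurable (lebesgue_on {a..b})"
    using assms(1) by (rule measurable_restrict_mono) (use assms(3) in auto)
  then show ?thesis
    using assms(2,3) by (auto simp: bounded_measurable_on_def intro!: exI[of _ C])
qed

text \<open>Green's identity lives on intervals away from 0, the covariance on the whole half line;
  this passes from one to the other.\<close>

lemma integral_pos_tendsto:
  fixes K :: "real \<Rightarrow> complex"
  assumes K: "K \<in> borel_measurable (lebesgue_on {0<..})"
    and bdd: "bounded (K ` {0<..b})" and b: "b > 0" and zero: "\<And>r. r > b \<Longrightarrow> K r = 0"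
  shows "((\<lambda>a. integral {a..b} K) \<longlongrightarrow> integral\<^sup>L (lebesgue_on {0<..}) K) (at_right 0)"
proof -
  \<comment> \<open>Nothing is known about \<open>K\<close> at 0, so it is extended by zero to be
    bounded and measurable on the closed interval.\<close>
  define K0 where "K0 x = (if x \<in> {0<..} then K x else 0)" for x
  have "K0 \<in> borel_measurable lebesgue"
    unfolding K0_def[abs_def] by (rule borel_measurable_if_I[OF K]) simp
  then have "K0 \<in> borel_measurable (lebesgue_on {0..b})"
    by (rule measurable_restrict_space1)
  moreover obtain M where M: "\<And>x. x \<in> {0<..b} \<Longrightarrow> norm (K x) \<le> M"
    using bdd unfolding bounded_iff by blast
  then have "\<forall>x\<in>{0..b}. norm (K0 x) \<le> max M 0"
    by (auto simp: K0_def le_max_iff_disj)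
  ultimately have bm: "bounded_measurable_on 0 b K0"
    unfolding bounded_measurable_on_def by blast
  have "integral\<^sup>L (lebesgue_on {0<..}) K = set_lebesgue_integral lebesgue {0<..} K"
    by (simp add: integral_restrict_space set_lebesgue_integral_def)
  also have "\<dots> = set_lebesgue_integral lebesgue {0..b} K0"
    unfolding set_lebesgue_integral_def using zero
    by (intro Bochner_Integration.integral_cong) (auto simp: indicator_def K0_def)
  also have "\<dots> = integral {0..b} K0"
    by (rule set_lebesgue_integral_eq_integral(2)[OF bounded_measurable_on_absolutely_integrable[OF bm]])
  finally have J: "integral\<^sup>L (lebesgue_on {0<..}) K = integral {0..b} K0" .
  have "continuous_on {0..b} (\<lambda>a. integral {a..b} K0)"
    by (rule indefinite_integral_continuous_1'[OF bounded_measurable_on_integrable[OF bm]])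
  then have "((\<lambda>a. integral {a..b} K0) \<longlongrightarrow> integral {0..b} K0) (at 0 within {0..b})"
    using b by (auto simp: continuous_on_def)
  then have "((\<lambda>a. integral {a..b} K0) \<longlongrightarrow> integral {0..b} K0) (at_right 0)"
    using b by (simp only: at_within_Icc_at_right)
  moreover have "integral {a..b} K0 = integral {a..b} K" if "a > 0" for a
    by (rule Henstock_Kurzweil_Integration.integral_cong) (use that in \<open>auto simp: K0_def\<close>)
  then have "\<forall>\<^sub>F a in at_right 0. integral {a..b} K0 = integral {a..b} K"
    by (auto simp: eventually_at_right_less intro: eventually_mono[OF eventually_at_right_less])
  ultimately show ?thesis unfolding J by (rule Lim_transform_eventually)
qed

text \<open>
  The Wronskian of two outgoing solutions is \<open>O(1/r)\<close>, which yields the symmetry of \<open>g\<close>; with one of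
  them conjugated it equals \<open>2 i k cnj (g r s) g r t + O(1/r)\<close>, which yields the asymptotic formula.
\<close>

lemma radial_green_identity:
  fixes g :: "real \<Rightarrow> real \<Rightarrow> complex" and V :: "real \<Rightarrow> complex" and l :: nat and k :: real
  defines "q \<equiv> \<lambda>r. of_real (real (l * (l + 1)) / r\<^sup>2) + V r - of_real (k\<^sup>2)"
  assumes V: "V \<in> borel_measurable (lebesgue_on {0<..})" "\<And>r. r > 0 \<Longrightarrow> norm (V r) \<le> C"
    and V_real: "\<And>r. r \<ge> Ra \<Longrightarrow> Im (V r) = 0" and k: "k > 0"
    and wg: "\<And>s. s > 0 \<Longrightarrow> weak_green q s (\<lambda>r. g r s)"
    and g0: "\<And>s. s > 0 \<Longrightarrow> (\<lambda>r. g r s) \<in> O[at_right 0](\<lambda>r. complex_of_real (r ^ (l + 1)))"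
    and out: "\<And>s. s > 0 \<Longrightarrow> \<exists>h c. is_coulomb_Hplus \<alpha> k l h \<and> (\<forall>\<^sub>F r in at_top. g r s = c * h r)"
    and st: "s > 0" "t > 0"
  shows "g s t = g t s" "bounded ((\<lambda>r. g r s) ` {0<..b0})"
    "(\<lambda>R. of_real (Im (g s t)) - (- (LINT r|lebesgue_on {0<..}. of_real (Im (V r)) * cnj (g r s) * g r t)
        + of_real k * cnj (g R s) * g R t)) \<in> O[at_top](\<lambda>R. complex_of_real (1 / R))"
proof -
  define L where "L = real (l * (l + 1))"
  have L: "L \<ge> 0" by (simp add: L_def)
  have q_alt: "q = (\<lambda>r. (of_real (L / r\<^sup>2) + V r) - of_real (k\<^sup>2))"
    by (simp add: q_def L_def)
  have bq: "bounded_measurable_on a b q" if "0 < a" for a b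
    unfolding q_alt
    by (intro bounded_measurable_on_add bounded_measurable_on_diff bounded_measurable_on_pos[OF V that]
        bounded_measurable_on_continuous continuous_intros) (use that in auto)
  have q0: "norm (q x) \<le> (L + C + k\<^sup>2) / x\<^sup>2" if x: "0 < x" "x \<le> 1" for x
  proof -
    have "x\<^sup>2 \<le> 1" using x by (simp add: power_le_one)
    then have ge: "c \<le> c / x\<^sup>2" if "c \<ge> 0" for c
      using x that mult_left_mono[of "x\<^sup>2" 1 c] by (simp add: field_simps)
    have "C \<ge> 0" using V(2)[OF x(1)] norm_ge_zero order_trans by blast
    have "norm (q x) \<le> norm (complex_of_real (L / x\<^sup>2) + V x) + norm (complex_of_real (k\<^sup>2))"
      unfolding q_alt by (rule norm_triangle_ineq4)
    also have "\<dots> \<le> (norm (complex_of_real (L / x\<^sup>2)) + norm (V x)) + norm (complex_of_real (k\<^sup>2))"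
      by (intro add_mono norm_triangle_ineq) simp
    also have "\<dots> \<le> (L / x\<^sup>2 + C / x\<^sup>2) + k\<^sup>2 / x\<^sup>2"
      using L ge[of "k\<^sup>2"] order_trans[OF V(2)[OF x(1)] ge[OF \<open>C \<ge> 0\<close>]]
      by (intro add_mono) (auto simp: norm_divide norm_power)
    finally show ?thesis by (simp add: add_divide_distrib)
  qed
  define e where "e = coulomb_wave \<alpha> k l"
  define e' where "e' r = \<i> * of_real k * e r" for r
  \<comment> \<open>The moduli are 1 and \<open>k\<close>; the product estimate wants a common
    bound.\<close>
  have e_le: "norm (e r) \<le> max 1 k" "norm (e' r) \<le> max 1 k" for r
    using k by (auto simp: e_def e'_def norm_mult)
  have ex: "\<exists>D c. (\<forall>a b. 0 < a \<longrightarrow> primitive_on a b (\<lambda>x. q x * g x s) D) \<and>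
      (\<forall>x>0. ((\<lambda>x. g x s + of_real (max 0 (x - s))) has_vector_derivative D x) (at x)) \<and>
      (\<lambda>r. g r s - c * e r) \<in> O[at_top](\<lambda>r. complex_of_real (1 / r)) \<and>
      (\<lambda>r. (D r - 1) - c * e' r) \<in> O[at_top](\<lambda>r. complex_of_real (1 / r)) \<and>
      ((\<lambda>r. g r s) \<longlongrightarrow> 0) (at_right 0) \<and> Bfun D (at_right 0)"
    if s: "s > 0" for s
  proof -
    obtain h c where h: "is_coulomb_Hplus \<alpha> k l h" "\<forall>\<^sub>F r in at_top. g r s = c * h r"
      using out[OF s] by blast
    show ?thesis
      by (rule outgoing_solution[OF wg[OF s] s bq q0 g0[OF s] k h]) (auto simp: e_def e'_def)
  qed
  obtain D1 c1 where prim1: "\<And>a b. 0 < a \<Longrightarrow> primitive_on a b (\<lambda>x. q x * g x s) D1"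
    and deriv1: "\<And>x. x > 0 \<Longrightarrow> ((\<lambda>x. g x s + of_real (max 0 (x - s))) has_vector_derivative D1 x) (at x)"
    and u1: "(\<lambda>r. g r s - c1 * e r) \<in> O[at_top](\<lambda>r. complex_of_real (1 / r))"
    and d1: "(\<lambda>r. (D1 r - 1) - c1 * e' r) \<in> O[at_top](\<lambda>r. complex_of_real (1 / r))"
    and lim1: "((\<lambda>r. g r s) \<longlongrightarrow> 0) (at_right 0)" and B1: "Bfun D1 (at_right 0)"
    using ex[OF st(1)] by blast
  obtain D2 c2 where prim2: "\<And>a b. 0 < a \<Longrightarrow> primitive_on a b (\<lambda>x. q x * g x t) D2"
    and deriv2: "\<And>x. x > 0 \<Longrightarrow> ((\<lambda>x. g x t + of_real (max 0 (x - t))) has_vector_derivative D2 x) (at x)"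
    and u2: "(\<lambda>r. g r t - c2 * e r) \<in> O[at_top](\<lambda>r. complex_of_real (1 / r))"
    and d2: "(\<lambda>r. (D2 r - 1) - c2 * e' r) \<in> O[at_top](\<lambda>r. complex_of_real (1 / r))"
    and lim2: "((\<lambda>r. g r t) \<longlongrightarrow> 0) (at_right 0)" and B2: "Bfun D2 (at_right 0)"
    using ex[OF st(2)] by blast
  \<comment> \<open>\<open>W\<close> is the Wronskian to the right of both sources,
    \<open>W0\<close> the one to the left; they differ in the slopes of the ramps.\<close>
  define W where "W r = g r s * (D2 r - 1) - g r t * (D1 r - 1)" for r
  define W0 where "W0 r = g r s * D2 r - g r t * D1 r" for r
  have W_big: "W \<in> O[at_top](\<lambda>r. complex_of_real (1 / r))"
  proof -
    \<comment> \<open>Both products have the leading coefficient c1 c2 on e e', which drops out of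
      the difference.\<close>
    have "(\<lambda>r. (g r s * (D2 r - 1) - c1 * c2 * (e r * e' r)) - (g r t * (D1 r - 1) - c2 * c1 * (e r * e' r)))
      \<in> O[at_top](\<lambda>r. complex_of_real (1 / r))"
      by (rule sum_in_bigo(2)[OF bigo_product_perturbation[OF u1 e_le(1) d2 e_le(2)]
          bigo_product_perturbation[OF u2 e_le(1) d1 e_le(2)]])
    then show ?thesis by (simp add: W_def[abs_def] mult.commute[of c1 c2])
  qed
  have W_lim: "(W \<longlongrightarrow> 0) at_top"
    using W_big unfolding bigo_inverse_at_top_iff
  proof (elim exE conjE)
    fix K N :: real assume K: "\<forall>r\<ge>N. norm (W r) \<le> K / r"
    have "((\<lambda>r. K / r) \<longlongrightarrow> 0) at_top"
      by (intro tendsto_divide_0[OF tendsto_const] filterlim_at_top_imp_at_infinity filterlim_ident)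
    moreover have "\<forall>\<^sub>F r in at_top. norm (W r) \<le> K / r"
      using K unfolding eventually_at_top_linorder by blast
    ultimately show ?thesis by (rule Lim_null_comparison[rotated])
  qed
  have ident: "W b - W0 a = g s t - g t s" if "0 < a" "a < s" "a < t" "s < b" "t < b" for a b
    using green_identity[OF wg[OF st(1)] wg[OF st(2)] prim1 prim2 deriv1 deriv2, of a b] that
    by (simp add: W_def W0_def)
  have pos_ev: "\<forall>\<^sub>F a in at_right 0. 0 < a \<and> a < s \<and> a < t"
    using st unfolding eventually_at_right_field by (intro exI[of _ "min s t"]) auto
  have top_ev: "\<forall>\<^sub>F b in at_top. s < b \<and> t < b"
    using eventually_gt_at_top[of s] eventually_gt_at_top[of t] by eventually_elim simp
  \<comment> \<open>With the same \<open>q\<close> on both sides there is no volume term; letting b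
    tend to infinity removes \<open>W\<close>, and letting a tend to 0 will remove
    \<open>W0\<close>.\<close>
  have W0_eq: "g s t - g t s = - W0 a" if "0 < a" "a < s" "a < t" for a
  proof -
    have "((\<lambda>b. W b - W0 a) \<longlongrightarrow> 0 - W0 a) at_top" by (intro tendsto_intros W_lim)
    moreover have "((\<lambda>b. W b - W0 a) \<longlongrightarrow> g s t - g t s) at_top"
      by (rule tendsto_eventually) (use top_ev in eventually_elim, use ident that in auto)
    ultimately show ?thesis using tendsto_unique[OF trivial_limit_at_top_linorder] by fastforce
  qed
  have "(W0 \<longlongrightarrow> 0) (at_right 0)"
    unfolding W0_def by (rule wronskian_tendsto_0[OF lim1 lim2 B1 B2])
  then have "((\<lambda>a. - W0 a) \<longlongrightarrow> - 0) (at_right 0)" by (rule tendsto_minus)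
  moreover have "((\<lambda>a. - W0 a) \<longlongrightarrow> g s t - g t s) (at_right 0)"
    by (rule tendsto_eventually) (use pos_ev in eventually_elim, use W0_eq in auto)
  ultimately have "g s t - g t s = - 0"
    using tendsto_unique[OF trivial_limit_at_right_real] by blast
  then show sym: "g s t = g t s" by simp
  have cont: "continuous_on {0<..} (\<lambda>r. g r s)" "continuous_on {0<..} (\<lambda>r. g r t)"
    using wg[OF st(1)] wg[OF st(2)] by (auto simp: weak_green_def)
  show bdd: "bounded ((\<lambda>r. g r s) ` {0<..b0})" for b0
    by (rule bounded_image_pos_interval[OF cont(1) lim1])
  have bdd2: "bounded ((\<lambda>r. g r t) ` {0<..b0})" for b0
    by (rule bounded_image_pos_interval[OF cont(2) lim2])
  define K where "K r = of_real (Im (V r)) * cnj (g r s) * g r t" for r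
  define J where "J = integral\<^sup>L (lebesgue_on {0<..}) K"
  define X where "X r = cnj (g r s) * (D2 r - 1) - g r t * (cnj (D1 r) - 1)" for r
  define X0 where "X0 r = cnj (g r s) * D2 r - g r t * cnj (D1 r)" for r
  have prim1c: "primitive_on a b (\<lambda>x. cnj (q x) * cnj (g x s)) (\<lambda>x. cnj (D1 x))" if "0 < a" for a b
    using primitive_on_cnj[OF prim1[OF that]] by simp
  have deriv1c: "((\<lambda>x. cnj (g x s) + of_real (max 0 (x - s))) has_vector_derivative cnj (D1 x)) (at x)" if "x > 0" for x
    using has_vector_derivative_cnj[OF deriv1[OF that]] by simp
  have identc: "X b - X0 a = g s t - cnj (g t s) + 2 * \<i> * integral {a..b} K"
    if "0 < a" "a < s" "a < t" "s < b" "t < b" for a b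
  proof -
    \<comment> \<open>Only the potential is complex, so conjugation leaves twice its imaginary
      part.\<close>
    have "(q x - cnj (q x)) * cnj (g x s) * g x t = 2 * \<i> * K x" for x
      by (simp add: q_def K_def complex_eq_iff)
    then show ?thesis
      using green_identity[OF weak_green_cnj[OF wg[OF st(1)]] wg[OF st(2)] prim1c prim2 deriv1c deriv2, of a b] that
      by (simp add: X_def X0_def)
  qed
  have K_meas: "K \<in> borel_measurable (lebesgue_on {0<..})"
  proof -
    have "(\<lambda>r. g r s) \<in> borel_measurable (lebesgue_on {0<..})" "(\<lambda>r. g r t) \<in> borel_measurable (lebesgue_on {0<..})"
      using cont by (auto intro: continuous_imp_measurable_on_sets_lebesgue)
    moreover have "(\<lambda>r. cnj (g r s)) \<in> borel_measurable (lebesgue_on {0<..})"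
      using cont(1) by (intro continuous_imp_measurable_on_sets_lebesgue continuous_intros) auto
    moreover have "(\<lambda>r. complex_of_real (Im (V r))) \<in> borel_measurable (lebesgue_on {0<..})"
      using V(1) by measurable
    ultimately show ?thesis unfolding K_def[abs_def] by measurable
  qed
  \<comment> \<open>Beyond Ra the integrand \<open>K\<close> vanishes, so the integral over (0, b)
    is already \<open>J\<close> and the right-hand side is independent of \<open>b\<close>.\<close>
  have X_eq: "X b = 2 * \<i> * (of_real (Im (g s t)) + J)" if b: "b > max 0 Ra" "b > s" "b > t" for b
  proof -
    obtain M1 where M1: "\<And>r. r \<in> {0<..b} \<Longrightarrow> norm (g r s) \<le> M1"
      using bdd[of b] unfolding bounded_iff by blast
    obtain M2 where M2: "\<And>r. r \<in> {0<..b} \<Longrightarrow> norm (g r t) \<le> M2"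
      using bdd2[of b] unfolding bounded_iff by blast
    have "norm (K r) \<le> C * M1 * M2" if r: "r \<in> {0<..b}" for r
    proof -
      have "\<bar>Im (V r)\<bar> \<le> C" using abs_Im_le_cmod[of "V r"] V(2)[of r] r by auto
      then have "\<bar>Im (V r)\<bar> * norm (g r s) * norm (g r t) \<le> C * M1 * M2"
        using M1[OF r] M2[OF r] order_trans[OF norm_ge_zero M1[OF r]]
        by (intro mult_mono mult_nonneg_nonneg) auto
      then show ?thesis by (simp add: K_def norm_mult)
    qed
    then have "bounded (K ` {0<..b})" unfolding bounded_iff by blast
    then have "((\<lambda>a. integral {a..b} K) \<longlongrightarrow> J) (at_right 0)"
      unfolding J_def using b V_real by (intro integral_pos_tendsto K_meas) (auto simp: K_def)
    moreover have "(X0 \<longlongrightarrow> 0) (at_right 0)"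
      unfolding X0_def
    proof (rule wronskian_tendsto_0)
      show "((\<lambda>r. cnj (g r s)) \<longlongrightarrow> 0) (at_right 0)"
        using tendsto_cnj[OF lim1] by simp
      show "Bfun (\<lambda>r. cnj (D1 r)) (at_right 0)"
        using B1 unfolding Bfun_def by simp
    qed (fact lim2 B2)+
    ultimately have "((\<lambda>a. X0 a + (g s t - cnj (g t s) + 2 * \<i> * integral {a..b} K)) \<longlongrightarrow> 0 + (g s t - cnj (g t s) + 2 * \<i> * J)) (at_right 0)"
      by (intro tendsto_intros)
    moreover have "((\<lambda>a. X0 a + (g s t - cnj (g t s) + 2 * \<i> * integral {a..b} K)) \<longlongrightarrow> X b) (at_right 0)"
    proof (rule tendsto_eventually)
      show "\<forall>\<^sub>F a in at_right 0. X0 a + (g s t - cnj (g t s) + 2 * \<i> * integral {a..b} K) = X b"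
        using pos_ev
      proof eventually_elim
        case (elim a)
        then show ?case using identc[of a b] b by (simp add: algebra_simps)
      qed
    qed
    ultimately have "X b = 0 + (g s t - cnj (g t s) + 2 * \<i> * J)"
      using tendsto_unique[OF trivial_limit_at_right_real] by blast
    moreover have "g s t - cnj (g t s) = 2 * \<i> * of_real (Im (g s t))"
      unfolding sym[symmetric] by (simp add: complex_eq_iff)
    ultimately show ?thesis by (simp add: algebra_simps)
  qed
  have u1c: "(\<lambda>r. cnj (g r s) - cnj c1 * cnj (e r)) \<in> O[at_top](\<lambda>r. complex_of_real (1 / r))"
    using bigo_cnj[OF u1] by simp
  have d1c: "(\<lambda>r. (cnj (D1 r) - 1) - cnj c1 * cnj (e' r)) \<in> O[at_top](\<lambda>r. complex_of_real (1 / r))"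
    using bigo_cnj[OF d1] by simp
  have ec_le: "norm (cnj (e r)) \<le> max 1 k" "norm (cnj (e' r)) \<le> max 1 k" for r
    using e_le[of r] by simp_all
  have e_cnj: "cnj (e r) * e r = 1" for r
    using complex_norm_square[of "e r"] by (simp add: e_def mult.commute)
  \<comment> \<open>Since e' = i k e, the first two leading terms combine to 2 i k cnj(c1) c2 |e|^2,
    which is the leading term subtracted in the third.\<close>
  have "(\<lambda>r. (cnj (g r s) * (D2 r - 1) - cnj c1 * c2 * (cnj (e r) * e' r))
      - (g r t * (cnj (D1 r) - 1) - c2 * cnj c1 * (e r * cnj (e' r)))
      - 2 * \<i> * of_real k * (cnj (g r s) * g r t - cnj c1 * c2 * (cnj (e r) * e r)))
      \<in> O[at_top](\<lambda>r. complex_of_real (1 / r))"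
    by (rule sum_in_bigo(2)[OF sum_in_bigo(2)[OF bigo_product_perturbation[OF u1c ec_le(1) d2 e_le(2)]
          bigo_product_perturbation[OF u2 e_le(1) d1c ec_le(2)]]
        bigo_mult_one_left[OF _ bigo_product_perturbation[OF u1c ec_le(1) u2 e_le(1)]]]) simp
  moreover have "(cnj (g r s) * (D2 r - 1) - cnj c1 * c2 * (cnj (e r) * e' r))
      - (g r t * (cnj (D1 r) - 1) - c2 * cnj c1 * (e r * cnj (e' r)))
      - 2 * \<i> * of_real k * (cnj (g r s) * g r t - cnj c1 * c2 * (cnj (e r) * e r))
      = X r - 2 * \<i> * of_real k * (cnj (g r s) * g r t)" for r
    by (simp add: X_def e'_def algebra_simps)
  ultimately have "(\<lambda>r. X r - 2 * \<i> * of_real k * (cnj (g r s) * g r t)) \<in> O[at_top](\<lambda>r. complex_of_real (1 / r))"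
    by simp
  then have "(\<lambda>r. 1 / (2 * \<i>) * (X r - 2 * \<i> * of_real k * (cnj (g r s) * g r t))) \<in> O[at_top](\<lambda>r. complex_of_real (1 / r))"
    by (intro bigo_mult_one_left) simp
  moreover have "\<forall>\<^sub>F R in at_top. of_real (Im (g s t)) - (- J + of_real k * cnj (g R s) * g R t)
      = 1 / (2 * \<i>) * (X R - 2 * \<i> * of_real k * (cnj (g R s) * g R t))"
    using eventually_gt_at_top[of "max 0 Ra"] top_ev
  proof eventually_elim
    case (elim R)
    then show ?case using X_eq[of R] by (simp add: field_simps)
  qed
  ultimately have "(\<lambda>R. of_real (Im (g s t)) - (- J + of_real k * cnj (g R s) * g R t)) \<in> O[at_top](\<lambda>R. complex_of_real (1 / R))"
    by (subst landau_o.big.in_cong)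
  then show "(\<lambda>R. of_real (Im (g s t)) - (- (LINT r|lebesgue_on {0<..}. of_real (Im (V r)) * cnj (g r s) * g r t)
        + of_real k * cnj (g R s) * g R t)) \<in> O[at_top](\<lambda>R. complex_of_real (1 / R))"
    by (simp add: J_def K_def[abs_def])
qed

section \<open>From the radial identity to the random source\<close>

text \<open>The potential enters the weak equation only under the integral, so values on a null set
  are immaterial. In the application \<open>p\<close> is the centrifugal term minus the
  energy.\<close>

lemma weak_green_AE_cong:
  fixes V V' p :: "real \<Rightarrow> complex"
  assumes wg: "weak_green (\<lambda>r. p r + V r) s u" and p: "continuous_on {0<..} p"
    and V: "V \<in> borel_measurable (lebesgue_on {0<..})" "V' \<in> borel_measurable (lebesgue_on {0<..})"
    and ae: "AE r in lebesgue_on {0<..}. V r = V' r"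
  shows "weak_green (\<lambda>r. p r + V' r) s u"
  unfolding weak_green_def
proof (intro conjI ballI)
  show u: "continuous_on {0<..} u" using wg by (simp add: weak_green_def)
  fix \<phi> :: "real \<Rightarrow> complex" assume \<phi>: "\<phi> \<in> test_functions {0<..}"
  then have "smooth_fun \<phi>" "smooth_fun (laplacian \<phi>)"
    by (auto simp: test_functions_def laplacian_real[abs_def] intro!: smooth_fun_pdiff)
  then have meas: "\<phi> \<in> borel_measurable (lebesgue_on {0<..})"
    "laplacian \<phi> \<in> borel_measurable (lebesgue_on {0<..})"
    "u \<in> borel_measurable (lebesgue_on {0<..})" "p \<in> borel_measurable (lebesgue_on {0<..})"
    using u p by (auto intro!: continuous_imp_measurable_on_sets_lebesgue smooth_fun_continuous_on)
  have "(LINT r|lebesgue_on {0<..}. u r * (- laplacian \<phi> r + (p r + V' r) * \<phi> r))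
      = (LINT r|lebesgue_on {0<..}. u r * (- laplacian \<phi> r + (p r + V r) * \<phi> r))"
    using meas V ae
    by (intro integral_cong_AE borel_measurable_times borel_measurable_add borel_measurable_uminus)
      (auto elim!: eventually_mono)
  then show "(LINT r|lebesgue_on {0<..}. u r * (- laplacian \<phi> r + (p r + V' r) * \<phi> r)) = \<phi> s"
    using wg \<phi> by (simp add: weak_green_def)
qed

theorem proposition1:
  fixes v :: "real^3 \<Rightarrow> complex" and vt :: "real \<Rightarrow> complex"
    and \<alpha> Ra k P r1 r2 :: real and l :: nat and m :: int
    and G :: "nat \<Rightarrow> real \<Rightarrow> real \<Rightarrow> complex"
    and M :: "real \<Rightarrow> 'w measure"
    and f :: "nat \<Rightarrow> int \<Rightarrow> real \<Rightarrow> (real \<Rightarrow> complex) \<Rightarrow> 'w \<Rightarrow> complex"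
  assumes v_radial: "\<forall>x. x \<noteq> 0 \<longrightarrow> v x = vt (norm x)"
    and vt_measurable: "vt \<in> borel_measurable (lebesgue_on {0<..})"
    and vt_bounded: "\<exists>C. AE r in lebesgue_on {0<..}. norm (vt r) \<le> C"
    and Ra_pos: "Ra > 0"
    and vt_tail: "\<forall>r\<ge>Ra. vt r = of_real (\<alpha> / r)"
    and k_pos: "k > 0"
    and k_regular: "k \<notin> Sigma_P v"
    and m_range: "\<bar>m\<bar> \<le> int l"
    and green: "is_radial_green vt \<alpha> k l (G l)"
    and P_pos: "P > 0"
    and source: "\<forall>R\<ge>Ra. random_source (M R) (f l m R)"
    and covariance: "\<forall>R\<ge>Ra. source_covariance vt k P R (M R) (f l m R)"
    and r1_pos: "r1 > 0" and r2_pos: "r2 > 0"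
  shows "(\<lambda>R. of_real (P * Im (G l r1 r2))
             - (LINT \<omega>|M R. cnj (radiation_solution (G l) (f l m R) r1 \<omega>)
                             * radiation_solution (G l) (f l m R) r2 \<omega>))
           \<in> O[at_top](\<lambda>R. complex_of_real (1 / R))"
proof -
  define g where "g = G l"
  obtain C where C: "AE r in lebesgue_on {0<..}. norm (vt r) \<le> C"
    using vt_bounded by blast
  \<comment> \<open>\<open>vt\<close> is only essentially bounded; changing it on a null set affects none of the integrals\<close>
  define V where "V r = (if norm (vt r) \<le> C then vt r else 0)" for r
  have V_meas: "V \<in> borel_measurable (lebesgue_on {0<..})"
    unfolding V_def[abs_def] using vt_measurable by measurable
  have V_AE: "AE r in lebesgue_on {0<..}. vt r = V r"
    using C by eventually_elim (simp add: V_def)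
  \<comment> \<open>The maximum with 0 covers the points where \<open>V\<close> has been set to 0,
    as \<open>C\<close> comes without a sign.\<close>
  have V_bounded: "norm (V r) \<le> max C 0" if "r > 0" for r
    by (auto simp: V_def)
  have V_real: "Im (V r) = 0" if "r \<ge> Ra" for r
    using vt_tail that by (simp add: V_def)
  have gr: "continuous_on {0<..} (\<lambda>r. g r s)"
    "\<And>\<phi>. \<phi> \<in> test_functions {0<..} \<Longrightarrow> (LINT r|lebesgue_on {0<..}. g r s * (- laplacian \<phi> r
       + (of_real (real (l * (l + 1)) / r\<^sup>2) + vt r - of_real (k\<^sup>2)) * \<phi> r)) = \<phi> s"
    "(\<lambda>r. g r s) \<in> O[at_right 0](\<lambda>r. complex_of_real (r ^ (l + 1)))"
    "\<exists>h c. is_coulomb_Hplus \<alpha> k l h \<and> (\<forall>\<^sub>F r in at_top. g r s = c * h r)" if "s > 0" for s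
    using green that unfolding is_radial_green_def g_def by blast+
  have wg: "weak_green (\<lambda>r. of_real (real (l * (l + 1)) / r\<^sup>2) + V r - of_real (k\<^sup>2)) s (\<lambda>r. g r s)"
    if s: "s > 0" for s
  proof -
    have eq: "(\<lambda>r. complex_of_real (real (l * (l + 1)) / r\<^sup>2) + W r - of_real (k\<^sup>2))
        = (\<lambda>r. (of_real (real (l * (l + 1)) / r\<^sup>2) - of_real (k\<^sup>2)) + W r)" for W
      by (simp add: algebra_simps)
    have "weak_green (\<lambda>r. of_real (real (l * (l + 1)) / r\<^sup>2) + vt r - of_real (k\<^sup>2)) s (\<lambda>r. g r s)"
      unfolding weak_green_def using gr(1,2)[OF s] by blast
    then show ?thesis
      unfolding eq by (rule weak_green_AE_cong[OF _ _ vt_measurable V_meas V_AE]) (intro continuous_intros, auto)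
  qed
  note identity = radial_green_identity[OF V_meas V_bounded V_real k_pos wg gr(3,4)]
  have sym: "g s t = g t s" if "s > 0" "t > 0" for s t
    using identity(1)[OF _ _ _ _ _ that] by blast
  \<comment> \<open>The definition gives continuity in the first argument; symmetry carries it over
    to the second, against which the source is tested.\<close>
  have cont_swap: "continuous_on {0<..} (g s)" if "s > 0" for s
    using gr(1)[OF that] by (rule continuous_on_eq) (use sym that in auto)
  have test: "g s \<in> source_test_functions" if s: "s > 0" for s
  proof -
    have "bounded ((\<lambda>r. g r s) ` {0<..1})"
      using identity(2)[OF _ _ _ _ _ s s] by blast
    moreover have "(\<lambda>r. g r s) ` {0<..1} = g s ` {0<..1}"
      by (rule image_cong) (use sym s in auto)
    ultimately show ?thesis using cont_swap[OF s] by (simp add: source_test_functions_def)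
  qed
  define J where "J = (LINT r|lebesgue_on {0<..}. of_real (Im (V r)) * cnj (g r r1) * g r r2)"
  have J_eq: "(LINT r|lebesgue_on {0<..}. of_real (Im (vt r)) * cnj (g r1 r) * g r2 r) = J"
    unfolding J_def
  proof (rule integral_cong_AE)
    have meas: "(\<lambda>r. complex_of_real (Im (W r)) * cnj (a r) * b r) \<in> borel_measurable (lebesgue_on {0<..})"
      if "W \<in> borel_measurable (lebesgue_on {0<..})" "continuous_on {0<..} a" "continuous_on {0<..} b"
      for W a b :: "real \<Rightarrow> complex"
    proof -
      have "(\<lambda>r. cnj (a r) * b r) \<in> borel_measurable (lebesgue_on {0<..})"
        using that(2,3) by (intro continuous_imp_measurable_on_sets_lebesgue continuous_intros) auto
      moreover have "(\<lambda>r. complex_of_real (Im (W r))) \<in> borel_measurable (lebesgue_on {0<..})"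
        using that(1) by measurable
      ultimately show ?thesis
        using borel_measurable_times by (fastforce simp: mult.assoc)
    qed
    show "(\<lambda>r. complex_of_real (Im (vt r)) * cnj (g r1 r) * g r2 r) \<in> borel_measurable (lebesgue_on {0<..})"
      by (rule meas[OF vt_measurable cont_swap[OF r1_pos] cont_swap[OF r2_pos]])
    show "(\<lambda>r. complex_of_real (Im (V r)) * cnj (g r r1) * g r r2) \<in> borel_measurable (lebesgue_on {0<..})"
      by (rule meas[OF V_meas gr(1)[OF r1_pos] gr(1)[OF r2_pos]])
    have "AE r in lebesgue_on {0<..}. r \<in> space (lebesgue_on {0::real<..})"
      by (rule AE_space)
    with V_AE show "AE r in lebesgue_on {0<..}. of_real (Im (vt r)) * cnj (g r1 r) * g r2 r
        = of_real (Im (V r)) * cnj (g r r1) * g r r2"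
      by eventually_elim (use sym r1_pos r2_pos in auto)
  qed
  \<comment> \<open>Exact for every admissible \<open>R\<close>: the covariance is evaluated at
    \<open>g r1\<close> and \<open>g r2\<close>, and symmetry exchanges the arguments at
    \<open>R\<close>.\<close>
  have expectation: "of_real (P * Im (G l r1 r2))
        - (LINT \<omega>|M R. cnj (radiation_solution (G l) (f l m R) r1 \<omega>) * radiation_solution (G l) (f l m R) r2 \<omega>)
      = of_real P * (of_real (Im (g r1 r2)) - (- J + of_real k * cnj (g R r1) * g R r2))" if R: "R \<ge> Ra" for R
  proof -
    have "R > 0" using R Ra_pos by simp
    have "(LINT \<omega>|M R. cnj (f l m R (g r1) \<omega>) * f l m R (g r2) \<omega>)
        = of_real P * (- J + of_real k * cnj (g r1 R) * g r2 R)"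
      using covariance R test[OF r1_pos] test[OF r2_pos] unfolding source_covariance_def J_eq[symmetric] by blast
    then show ?thesis
      using sym[OF r1_pos \<open>R > 0\<close>] sym[OF r2_pos \<open>R > 0\<close>]
      by (simp add: radiation_solution_def g_def right_diff_distrib)
  qed
  have "(\<lambda>R. of_real P * (of_real (Im (g r1 r2)) - (- J + of_real k * cnj (g R r1) * g R r2)))
      \<in> O[at_top](\<lambda>R. complex_of_real (1 / R))"
    unfolding J_def using identity(3)[OF _ _ _ _ _ r1_pos r2_pos] by (intro bigo_mult_one_left) auto
  moreover have "\<forall>\<^sub>F R in at_top. of_real (P * Im (G l r1 r2))
        - (LINT \<omega>|M R. cnj (radiation_solution (G l) (f l m R) r1 \<omega>) * radiation_solution (G l) (f l m R) r2 \<omega>)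
      = of_real P * (of_real (Im (g r1 r2)) - (- J + of_real k * cnj (g R r1) * g R r2))"
    using eventually_ge_at_top[of Ra] by eventually_elim (rule expectation)
  ultimately show ?thesis
    by (subst landau_o.big.in_cong)
qed

end
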